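(* Let $K$ be an infinite field. Any formula with divisions (i.e. with inverse gates allowed) computing the non-commutative determinant of degree $k$, or the non-commutative permanent of degree $k$, has size $2^{\Omega(\sqrt{k}/\log(k))}$; that is, there is a constant $c>0$ such that for all sufficiently large $k$ every such formula has size at least $2^{c\sqrt{k}/\log(k)}$.
   Context: The non-commutative determinant and permanent of degree $k$ are the elements $\sum_{\pi\in S_k}\mathrm{sgn}(\pi)\,x_{1,\pi(1)}x_{2,\pi(2)}\cdots x_{k,\pi(k)}$ and $\sum_{\pi\in S_k}x_{1,\pi(1)}x_{2,\pi(2)}\cdots x_{k,\pi(k)}$ of the free associative algebra over $K$ in the $k^2$ variables $x_{i,j}$, viewed inside the free skew field on these variables. A non-commutative arithmetic circuit is a directed acyclic graph whose vertices are called gates: gates of in-degree $0$ are elements of $K$ or variables; the other allowed gates are inverse (in-degree 1), addition (in-degree 2) and multiplication (in-degree 2) gates, the two edges entering a multiplication gate being labelled left and right. A formula is a circuit in which every node has out-degree at most $1$. The size of a circuit is its number of gates. A circuit computes, at each output gate, an element of the free skew field (a non-commutative rational function). *)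

theory Defs
  imports
    Complex_Main
    "HOL-Algebra.Ring"
    "HOL-Combinatorics.Permutations"
    "Jordan_Normal_Form.Gauss_Jordan_Elimination"
    "Graph_Theory.Digraph"
begin

section \<open>The free skew field\<close>

text \<open>
  Over an infinite field the free skew field is built as by Amitsur: its elements are
  the non-degenerate rational expressions, identified when they agree at all tuples of
  square matrices (of every size) at which both are defined.
\<close>

datatype ('k, rvars: 'x) rexp =
    RConst 'k
  | RVar 'x
  | RAdd "('k, 'x) rexp" "('k, 'x) rexp"
  | RMul "('k, 'x) rexp" "('k, 'x) rexp"
  | RInv "('k, 'x) rexp"

text \<open>
  The value at a tuple of \<open>n\<close> by \<open>n\<close> matrices; it is \<open>None\<close> as soon as some subexpression to be
  inverted is undefined or singular.
\<close>

primrec mat_eval :: "nat \<Rightarrow> ('x \<Rightarrow> 'k::field mat) \<Rightarrow> ('k, 'x) rexp \<Rightarrow> 'k mat option" where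
  "mat_eval n a (RConst c) = Some (c \<cdot>\<^sub>m 1\<^sub>m n)"
| "mat_eval n a (RVar x) = Some (a x)"
| "mat_eval n a (RAdd r s) =
     Option.bind (mat_eval n a r) (\<lambda>A. Option.bind (mat_eval n a s) (\<lambda>B. Some (A + B)))"
| "mat_eval n a (RMul r s) =
     Option.bind (mat_eval n a r) (\<lambda>A. Option.bind (mat_eval n a s) (\<lambda>B. Some (A * B)))"
| "mat_eval n a (RInv r) = Option.bind (mat_eval n a r) mat_inverse"

definition mat_points :: "'x set \<Rightarrow> nat \<Rightarrow> ('x \<Rightarrow> 'k mat) set" where
  "mat_points X n = {a. \<forall>x\<in>X. a x \<in> carrier_mat n n}"

text \<open>
  The condition \<open>n > 0\<close> matters: every matrix of size \<open>0\<close> is invertible.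
\<close>

definition nondegenerate :: "'x set \<Rightarrow> ('k::field, 'x) rexp set" where
  "nondegenerate X =
     {r. rvars r \<subseteq> X \<and> (\<exists>n>0. \<exists>a\<in>mat_points X n. mat_eval n a r \<noteq> None)}"

definition rexp_rel :: "'x set \<Rightarrow> (('k::field, 'x) rexp \<times> ('k, 'x) rexp) set" where
  "rexp_rel X = {(r, s). r \<in> nondegenerate X \<and> s \<in> nondegenerate X \<and>
     (\<forall>n>0. \<forall>a\<in>mat_points X n. \<forall>A B.
        mat_eval n a r = Some A \<longrightarrow> mat_eval n a s = Some B \<longrightarrow> A = B)}"

definition rexp_class :: "'x set \<Rightarrow> ('k::field, 'x) rexp \<Rightarrow> ('k, 'x) rexp set" where
  "rexp_class X r = rexp_rel X `` {r}"

definition free_skew_field :: "'x set \<Rightarrow> ('k::field, 'x) rexp set ring" where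
  "free_skew_field X =
     \<lparr> carrier = nondegenerate X // rexp_rel X,
       mult = (\<lambda>P Q. \<Union>r\<in>P. \<Union>s\<in>Q. rexp_class X (RMul r s)),
       one = rexp_class X (RConst 1),
       zero = rexp_class X (RConst 0),
       add = (\<lambda>P Q. \<Union>r\<in>P. \<Union>s\<in>Q. rexp_class X (RAdd r s)) \<rparr>"


section \<open>The non-commutative determinant and permanent\<close>

definition matrix_vars :: "nat \<Rightarrow> (nat \<times> nat) set" where
  "matrix_vars k = {1..k} \<times> {1..k}"

text \<open>The monomial \<open>x\<^bsub>1,\<pi>(1)\<^esub> x\<^bsub>2,\<pi>(2)\<^esub> \<cdots> x\<^bsub>k,\<pi>(k)\<^esub>\<close>, its factors in this order.\<close>

definition perm_monomial :: "nat \<Rightarrow> (nat \<Rightarrow> nat) \<Rightarrow> ('k::field, nat \<times> nat) rexp set" where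
  "perm_monomial k \<pi> =
     (let F = free_skew_field (matrix_vars k) in
      foldr (\<lambda>i P. rexp_class (matrix_vars k) (RVar (i, \<pi> i)) \<otimes>\<^bsub>F\<^esub> P) [1..<Suc k] \<one>\<^bsub>F\<^esub>)"

definition nc_det :: "nat \<Rightarrow> ('k::field, nat \<times> nat) rexp set" where
  "nc_det k =
     (let F = free_skew_field (matrix_vars k) in
      \<Oplus>\<^bsub>F\<^esub>\<pi>\<in>{\<pi>. \<pi> permutes {1..k}}.
        rexp_class (matrix_vars k) (RConst (of_int (sign \<pi>))) \<otimes>\<^bsub>F\<^esub> perm_monomial k \<pi>)"

definition nc_perm :: "nat \<Rightarrow> ('k::field, nat \<times> nat) rexp set" where
  "nc_perm k =
     (let F = free_skew_field (matrix_vars k) in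
      \<Oplus>\<^bsub>F\<^esub>\<pi>\<in>{\<pi>. \<pi> permutes {1..k}}. perm_monomial k \<pi>)"


section \<open>Circuits and formulas with divisions\<close>

datatype ('k, 'x) gate = ConstGate 'k | VarGate 'x | InvGate | AddGate | MulGate

text \<open>
  The underlying graph may have parallel edges, since a gate may feed both inputs of another
  one. The arcs in \<open>left_arcs\<close> carry the label ``left''.
\<close>

record ('k, 'x, 'v, 'e) circuit =
  graph :: "('v, 'e) pre_digraph"
  gate :: "'v \<Rightarrow> ('k, 'x) gate"
  left_arcs :: "'e set"

definition well_formed_gate :: "'x set \<Rightarrow> ('k, 'x, 'v, 'e) circuit \<Rightarrow> 'v \<Rightarrow> bool" where
  "well_formed_gate X \<Phi> v =
     (case gate \<Phi> v of
        ConstGate c \<Rightarrow> in_degree (graph \<Phi>) v = 0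
      | VarGate x \<Rightarrow> x \<in> X \<and> in_degree (graph \<Phi>) v = 0
      | InvGate \<Rightarrow> in_degree (graph \<Phi>) v = 1
      | AddGate \<Rightarrow> in_degree (graph \<Phi>) v = 2
      | MulGate \<Rightarrow> in_degree (graph \<Phi>) v = 2 \<and>
          card (in_arcs (graph \<Phi>) v \<inter> left_arcs \<Phi>) = 1)"

definition is_circuit :: "'x set \<Rightarrow> ('k, 'x, 'v, 'e) circuit \<Rightarrow> bool" where
  "is_circuit X \<Phi> \<longleftrightarrow>
     fin_digraph (graph \<Phi>) \<and> acyclic (arcs_ends (graph \<Phi>)) \<and>
     (\<forall>v\<in>verts (graph \<Phi>). well_formed_gate X \<Phi> v)"

definition is_formula :: "'x set \<Rightarrow> ('k, 'x, 'v, 'e) circuit \<Rightarrow> bool" where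
  "is_formula X \<Phi> \<longleftrightarrow>
     is_circuit X \<Phi> \<and> (\<forall>v\<in>verts (graph \<Phi>). out_degree (graph \<Phi>) v \<le> 1)"

definition circuit_size :: "('k, 'x, 'v, 'e) circuit \<Rightarrow> nat" where
  "circuit_size \<Phi> = card (verts (graph \<Phi>))"

text \<open>
  \<open>val\<close> assigns to each gate the element of the free skew field computed there. An inverse gate
  is admissible only if its input is a unit, i.e. nonzero.
\<close>

definition gate_value_ok ::
  "'x set \<Rightarrow> ('k::field, 'x, 'v, 'e) circuit \<Rightarrow> ('v \<Rightarrow> ('k, 'x) rexp set) \<Rightarrow> 'v \<Rightarrow> bool" where
  "gate_value_ok X \<Phi> val v =
     (let F = free_skew_field X; G = graph \<Phi> in
      case gate \<Phi> v of
        ConstGate c \<Rightarrow> val v = rexp_class X (RConst c)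
      | VarGate x \<Rightarrow> val v = rexp_class X (RVar x)
      | InvGate \<Rightarrow> (\<exists>e. in_arcs G v = {e} \<and>
          val (tail G e) \<in> Units F \<and> val v = inv\<^bsub>F\<^esub> val (tail G e))
      | AddGate \<Rightarrow> (\<exists>d e. d \<noteq> e \<and> in_arcs G v = {d, e} \<and>
          val v = val (tail G d) \<oplus>\<^bsub>F\<^esub> val (tail G e))
      | MulGate \<Rightarrow> (\<exists>d e. d \<in> left_arcs \<Phi> \<and> e \<notin> left_arcs \<Phi> \<and> in_arcs G v = {d, e} \<and>
          val v = val (tail G d) \<otimes>\<^bsub>F\<^esub> val (tail G e)))"

definition computes ::
  "'x set \<Rightarrow> ('k::field, 'x, 'v, 'e) circuit \<Rightarrow> ('k, 'x) rexp set \<Rightarrow> bool" where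
  "computes X \<Phi> f \<longleftrightarrow>
     (\<exists>val. (\<forall>v\<in>verts (graph \<Phi>). gate_value_ok X \<Phi> val v) \<and>
        (\<exists>v\<in>verts (graph \<Phi>). out_degree (graph \<Phi>) v = 0 \<and> val v = f))"

end

theory Submission
  imports Defs "Jordan_Normal_Form.Determinant"
begin

text \<open>
  Fix a point \<open>A\<close> of \<open>m\<close> by \<open>m\<close> matrices at which a formula for the determinant is defined, and
  perturb \<open>A \<otimes> I\<close> by putting \<open>m\<close> by \<open>m\<close> blocks on the superdiagonal. The formula stays defined at
  such a block bidiagonal point, and its upper right corner block there is the determinant (or
  permanent) of the superdiagonal blocks alone. Cut the blocks after the \<open>h\<close>-th step. By induction
  on the formula, the off-diagonal part across the cut factors as \<open>P(left) Q(right)\<close>, where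
  \<open>left\<close> and \<open>right\<close> are the superdiagonal blocks on the two sides, with inner dimension
  at most \<open>m\<close> times the number of leaves: sums and products add the inner dimensions and inverses
  preserve them. On the other hand, taking matrix units as superdiagonal blocks, one finds a
  monomial submatrix of size \<open>m\<close> times the binomial coefficient of \<open>k\<close> over \<open>h\<close>, as in Nisan's rank
  argument. The factor \<open>m\<close> cancels, so no bound on the dimension of \<open>A\<close> is needed.
\<close>

section \<open>Evaluation at matrices\<close>

text \<open>Matrix points are forced: a formula that inverts a commutator is undefined at all scalar
  points, so it has no power series expansion around one. A nondegenerate expression is defined at
  some matrix point \<open>A\<close>, but nothing bounds the size \<open>m\<close> of that point in
  terms of the formula. The lower count therefore has to grow with \<open>m\<close> too. It does
  because the data at the cut are a set of \<open>h\<close> columns together with one of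
  \<open>m\<close> basis vectors, handed over from the left superdiagonal blocks to the right ones.
  The diagonal blocks stay out of the corner because there are \<open>k + 1\<close> blocks and a
  monomial has \<open>k\<close> factors, each moving at most one block up: the last block is reached
  only by superdiagonal steps throughout. The field being infinite serves a different purpose:
  expressions are identified by agreement where both are defined, and to work with representatives
  one needs points where several of them are defined at once. Such points are found on lines of
  matrices, where an expression fails at finitely many parameters.\<close>

lemma mat_inverse_SomeI:
  fixes A :: "'k::field mat"
  assumes A: "A \<in> carrier_mat n n" and B: "B \<in> carrier_mat n n" and AB: "A * B = 1\<^sub>m n"
  shows "mat_inverse A = Some B"
proof -
  have BA: "B * A = 1\<^sub>m n" by (rule mat_mult_left_right_inverse[OF A B AB])
  have "A \<in> Units (ring_mat TYPE('k) n ())"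
    unfolding Units_def using A B AB BA by (auto simp: ring_mat_simps)
  then obtain C where C: "mat_inverse A = Some C" using mat_inverse(1)[OF A, where b="()"] by (cases "mat_inverse A") auto
  have "C \<in> carrier_mat n n" "C * A = 1\<^sub>m n" using mat_inverse(2)[OF A C] by auto
  then have "C = B" using A B AB
    using assoc_mult_mat[of C n n A n B n] by simp
  with C show ?thesis by simp
qed

lemma mat_eval_cong:
  assumes "rvars r \<subseteq> X" "\<forall>x\<in>X. a x = b x"
  shows "mat_eval n a r = mat_eval n b r"
  using assms by (induction r) auto

lemma mat_eval_carrier:
  assumes "rvars r \<subseteq> X" "a \<in> mat_points X n" "mat_eval n a r = Some A"
  shows "A \<in> carrier_mat n n"
  using assms
proof (induction r arbitrary: A)
  case (RInv r)
  then obtain B where "mat_eval n a r = Some B" "mat_inverse B = Some A"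
    by (auto simp: bind_eq_Some_conv)
  with RInv.IH[OF _ RInv.prems(2)] RInv.prems(1) mat_inverse(2)[of B n A] show ?case by simp
next
  case (RMul r s)
  then obtain B C where "mat_eval n a r = Some B" "mat_eval n a s = Some C" "A = B * C"
    by (auto simp: bind_eq_Some_conv)
  with RMul.IH(1)[OF _ RMul.prems(2), of B] RMul.IH(2)[OF _ RMul.prems(2), of C] RMul.prems(1)
  show ?case by (simp add: mult_carrier_mat)
next
  case (RAdd r s)
  then obtain B C where "mat_eval n a r = Some B" "mat_eval n a s = Some C" "A = B + C"
    by (auto simp: bind_eq_Some_conv)
  with RAdd.IH(2)[OF _ RAdd.prems(2), of C] RAdd.prems(1) show ?case by simp
qed (auto simp: mat_points_def)

text \<open>Constants count zero because a scalar matrix is block diagonal and carries nothing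
  across the cut. Only variables bring in superdiagonal blocks, with inner dimension
  \<open>d\<close> each.\<close>

primrec var_leaves :: "('k, 'x) rexp \<Rightarrow> nat" where
  "var_leaves (RConst c) = 0"
| "var_leaves (RVar x) = 1"
| "var_leaves (RAdd r s) = var_leaves r + var_leaves s"
| "var_leaves (RMul r s) = var_leaves r + var_leaves s"
| "var_leaves (RInv r) = var_leaves r"

text \<open>\<open>four_block_mat\<close> with an empty second block row puts matrices side by side,
  with an empty second block column it stacks them. A sum of two factored matrices thus factors
  again, the inner dimensions adding up.\<close>

lemma mult_append_blocks:
  fixes P P' Q Q' :: "'k::field mat"
  assumes P: "P \<in> carrier_mat p n" "P' \<in> carrier_mat p n'"
    and Q: "Q \<in> carrier_mat n q" "Q' \<in> carrier_mat n' q"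
  shows "four_block_mat P P' (0\<^sub>m 0 n) (0\<^sub>m 0 n') * four_block_mat Q (0\<^sub>m n 0) Q' (0\<^sub>m n' 0)
    = P * Q + P' * Q'"
  by (subst mult_four_block_mat[OF P zero_carrier_mat zero_carrier_mat Q(1) zero_carrier_mat Q(2) zero_carrier_mat])
    (use assms in \<open>auto intro!: eq_matI\<close>)

text \<open>The new left factor still sees only \<alpha> and the new right factor only \<beta>; the
  rank bound rests on this separation.\<close>

lemma append_blocks:
  fixes P P' :: "'a \<Rightarrow> 'k::field mat" and Q Q' :: "'b \<Rightarrow> 'k mat"
  assumes P: "\<forall>\<alpha>\<in>I. P \<alpha> \<in> carrier_mat p n \<and> P' \<alpha> \<in> carrier_mat p n'"
    and Q: "\<forall>\<beta>\<in>J. Q \<beta> \<in> carrier_mat n q \<and> Q' \<beta> \<in> carrier_mat n' q"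
  obtains P'' Q'' where
    "\<forall>\<alpha>\<in>I. P'' \<alpha> \<in> carrier_mat p (n + n')" "\<forall>\<beta>\<in>J. Q'' \<beta> \<in> carrier_mat (n + n') q"
    "\<forall>\<alpha>\<in>I. \<forall>\<beta>\<in>J. P'' \<alpha> * Q'' \<beta> = P \<alpha> * Q \<beta> + P' \<alpha> * Q' \<beta>"
proof
  let ?P = "\<lambda>\<alpha>. four_block_mat (P \<alpha>) (P' \<alpha>) (0\<^sub>m 0 n) (0\<^sub>m 0 n')"
  let ?Q = "\<lambda>\<beta>. four_block_mat (Q \<beta>) (0\<^sub>m n 0) (Q' \<beta>) (0\<^sub>m n' 0)"
  show "\<forall>\<alpha>\<in>I. ?P \<alpha> \<in> carrier_mat p (n + n')"
    using P by (metis four_block_carrier_mat add.right_neutral zero_carrier_mat)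
  show "\<forall>\<beta>\<in>J. ?Q \<beta> \<in> carrier_mat (n + n') q"
    using Q by (metis four_block_carrier_mat add.right_neutral zero_carrier_mat)
  show "\<forall>\<alpha>\<in>I. \<forall>\<beta>\<in>J. ?P \<alpha> * ?Q \<beta> = P \<alpha> * Q \<beta> + P' \<alpha> * Q' \<beta>"
    using P Q by (blast intro: mult_append_blocks)
qed

section \<open>Evaluation at block triangular points\<close>

lemma mult_block_triangular:
  fixes A1 :: "'k::field mat"
  assumes 1: "A1 \<in> carrier_mat p p" "C1 \<in> carrier_mat p q" "B1 \<in> carrier_mat q q"
    and 2: "A2 \<in> carrier_mat p p" "C2 \<in> carrier_mat p q" "B2 \<in> carrier_mat q q"
  shows "four_block_mat A1 C1 (0\<^sub>m q p) B1 * four_block_mat A2 C2 (0\<^sub>m q p) B2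
    = four_block_mat (A1 * A2) (A1 * C2 + C1 * B2) (0\<^sub>m q p) (B1 * B2)"
proof -
  have "A1 * A2 + C1 * 0\<^sub>m q p = A1 * A2" "0\<^sub>m q p * C2 + B1 * B2 = B1 * B2"
    "0\<^sub>m q p * A2 + B1 * 0\<^sub>m q p = 0\<^sub>m q p"
    using right_mult_zero_mat[OF 1(2), of p] left_mult_zero_mat[OF 2(2), of q]
      left_mult_zero_mat[OF 2(1), of q] right_mult_zero_mat[OF 1(3), of p]
      mult_carrier_mat[OF 1(1) 2(1)] mult_carrier_mat[OF 1(3) 2(3)] by simp_all
  then show ?thesis
    by (simp only: mult_four_block_mat[OF 1(1,2) zero_carrier_mat 1(3) 2(1,2) zero_carrier_mat 2(3)])
qed

text \<open>The zero corner is written as a product through inner dimension 0, the shape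
  \<open>P * Q\<close> expected of an expression without variable leaves.\<close>

lemma smult_block_one:
  fixes c :: "'k::field"
  shows "c \<cdot>\<^sub>m 1\<^sub>m (p + q) = four_block_mat (c \<cdot>\<^sub>m 1\<^sub>m p) (0\<^sub>m p 0 * 0\<^sub>m 0 q) (0\<^sub>m q p) (c \<cdot>\<^sub>m 1\<^sub>m q)"
proof -
  have "c \<cdot>\<^sub>m four_block_mat (1\<^sub>m p) (0\<^sub>m p q) (0\<^sub>m q p) (1\<^sub>m q)
    = four_block_mat (c \<cdot>\<^sub>m 1\<^sub>m p) (c \<cdot>\<^sub>m 0\<^sub>m p q) (c \<cdot>\<^sub>m 0\<^sub>m q p) (c \<cdot>\<^sub>m 1\<^sub>m q)"
    by (rule smult_four_block_mat) auto
  then show ?thesis by (simp add: smult_zero_mat)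
qed

text \<open>Corners obey Leibniz-like rules: a product has corner \<open>A1 * C2 + C1 * B2\<close>,
  an inverse has \<open>- A * C * B\<close> with inverted diagonal blocks \<open>A\<close> and
  \<open>B\<close>. The diagonal blocks depend on \<alpha> alone or on \<beta> alone, so they can be
  absorbed into the outer factors. Whole families are treated at once since \<open>P\<close> and
  \<open>Q\<close> chosen for a single pair could depend on both indices. Invertibility is decided
  by the diagonal blocks, which is why being defined at both of them suffices.\<close>

lemma mat_eval_block_triangular:
  fixes a :: "'a \<Rightarrow> 'x \<Rightarrow> 'k::field mat" and b :: "'b \<Rightarrow> 'x \<Rightarrow> 'k mat"
  assumes a: "\<forall>\<alpha>\<in>I. a \<alpha> \<in> mat_points X p" and b: "\<forall>\<beta>\<in>J. b \<beta> \<in> mat_points X q"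
    and U: "\<forall>\<alpha>\<in>I. \<forall>x\<in>X. U \<alpha> x \<in> carrier_mat p d"
    and W: "\<forall>\<beta>\<in>J. \<forall>x\<in>X. W \<beta> x \<in> carrier_mat d q"
    and r: "rvars r \<subseteq> X"
    and A: "\<forall>\<alpha>\<in>I. mat_eval p (a \<alpha>) r = Some (A \<alpha>)"
    and B: "\<forall>\<beta>\<in>J. mat_eval q (b \<beta>) r = Some (B \<beta>)"
  shows "\<exists>P Q. (\<forall>\<alpha>\<in>I. P \<alpha> \<in> carrier_mat p (var_leaves r * d)) \<and>
    (\<forall>\<beta>\<in>J. Q \<beta> \<in> carrier_mat (var_leaves r * d) q) \<and>
    (\<forall>\<alpha>\<in>I. \<forall>\<beta>\<in>J. mat_eval (p + q)
       (\<lambda>x. four_block_mat (a \<alpha> x) (U \<alpha> x * W \<beta> x) (0\<^sub>m q p) (b \<beta> x)) r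
       = Some (four_block_mat (A \<alpha>) (P \<alpha> * Q \<beta>) (0\<^sub>m q p) (B \<beta>)))"
  using r A B
proof (induction r arbitrary: A B)
  case (RConst c)
  then show ?case
    by (rule_tac exI[of _ "\<lambda>_. 0\<^sub>m p 0"], rule_tac exI[of _ "\<lambda>_. 0\<^sub>m 0 q"])
      (auto simp: smult_block_one)
next
  case (RVar x)
  then show ?case using U W
    by (rule_tac exI[of _ "\<lambda>\<alpha>. U \<alpha> x"], rule_tac exI[of _ "\<lambda>\<beta>. W \<beta> x"]) auto
next
  case (RAdd r s)
  define A1 where "A1 = (\<lambda>\<alpha>. the (mat_eval p (a \<alpha>) r))"
  define A2 where "A2 = (\<lambda>\<alpha>. the (mat_eval p (a \<alpha>) s))"
  have A12: "\<forall>\<alpha>\<in>I. mat_eval p (a \<alpha>) r = Some (A1 \<alpha>)"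
      "\<forall>\<alpha>\<in>I. mat_eval p (a \<alpha>) s = Some (A2 \<alpha>)" "\<forall>\<alpha>\<in>I. A \<alpha> = A1 \<alpha> + A2 \<alpha>"
    using RAdd.prems(2) unfolding A1_def A2_def by (auto simp: bind_eq_Some_conv)
  define B1 where "B1 = (\<lambda>\<beta>. the (mat_eval q (b \<beta>) r))"
  define B2 where "B2 = (\<lambda>\<beta>. the (mat_eval q (b \<beta>) s))"
  have B12: "\<forall>\<beta>\<in>J. mat_eval q (b \<beta>) r = Some (B1 \<beta>)"
      "\<forall>\<beta>\<in>J. mat_eval q (b \<beta>) s = Some (B2 \<beta>)" "\<forall>\<beta>\<in>J. B \<beta> = B1 \<beta> + B2 \<beta>"
    using RAdd.prems(3) unfolding B1_def B2_def by (auto simp: bind_eq_Some_conv)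
  have rs: "rvars r \<subseteq> X" "rvars s \<subseteq> X" using RAdd.prems(1) by auto
  obtain P1 Q1 where 1: "\<forall>\<alpha>\<in>I. P1 \<alpha> \<in> carrier_mat p (var_leaves r * d)"
      "\<forall>\<beta>\<in>J. Q1 \<beta> \<in> carrier_mat (var_leaves r * d) q"
      "\<forall>\<alpha>\<in>I. \<forall>\<beta>\<in>J. mat_eval (p + q)
       (\<lambda>x. four_block_mat (a \<alpha> x) (U \<alpha> x * W \<beta> x) (0\<^sub>m q p) (b \<beta> x)) r
       = Some (four_block_mat (A1 \<alpha>) (P1 \<alpha> * Q1 \<beta>) (0\<^sub>m q p) (B1 \<beta>))"
    using RAdd.IH(1)[OF rs(1) A12(1) B12(1)] by blast
  obtain P2 Q2 where 2: "\<forall>\<alpha>\<in>I. P2 \<alpha> \<in> carrier_mat p (var_leaves s * d)"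
      "\<forall>\<beta>\<in>J. Q2 \<beta> \<in> carrier_mat (var_leaves s * d) q"
      "\<forall>\<alpha>\<in>I. \<forall>\<beta>\<in>J. mat_eval (p + q)
       (\<lambda>x. four_block_mat (a \<alpha> x) (U \<alpha> x * W \<beta> x) (0\<^sub>m q p) (b \<beta> x)) s
       = Some (four_block_mat (A2 \<alpha>) (P2 \<alpha> * Q2 \<beta>) (0\<^sub>m q p) (B2 \<beta>))"
    using RAdd.IH(2)[OF rs(2) A12(2) B12(2)] by blast
  have PP: "\<forall>\<alpha>\<in>I. P1 \<alpha> \<in> carrier_mat p (var_leaves r * d) \<and> P2 \<alpha> \<in> carrier_mat p (var_leaves s * d)"
    and QQ: "\<forall>\<beta>\<in>J. Q1 \<beta> \<in> carrier_mat (var_leaves r * d) q \<and> Q2 \<beta> \<in> carrier_mat (var_leaves s * d) q"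
    using 1 2 by auto
  obtain P Q where PQ: "\<forall>\<alpha>\<in>I. P \<alpha> \<in> carrier_mat p (var_leaves r * d + var_leaves s * d)"
    "\<forall>\<beta>\<in>J. Q \<beta> \<in> carrier_mat (var_leaves r * d + var_leaves s * d) q"
    "\<forall>\<alpha>\<in>I. \<forall>\<beta>\<in>J. P \<alpha> * Q \<beta> = P1 \<alpha> * Q1 \<beta> + P2 \<alpha> * Q2 \<beta>"
    by (rule append_blocks[OF PP QQ]) blast
  have car: "A1 \<alpha> \<in> carrier_mat p p" "A2 \<alpha> \<in> carrier_mat p p" if "\<alpha> \<in> I" for \<alpha>
    using that a A12 rs by (auto intro: mat_eval_carrier)
  have car': "B1 \<beta> \<in> carrier_mat q q" "B2 \<beta> \<in> carrier_mat q q" if "\<beta> \<in> J" for \<beta>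
    using that b B12 rs by (auto intro: mat_eval_carrier)
  show ?case
  proof (intro exI[of _ P] exI[of _ Q] conjI ballI)
    fix \<alpha> \<beta> assume ab: "\<alpha> \<in> I" "\<beta> \<in> J"
    have "P1 \<alpha> * Q1 \<beta> \<in> carrier_mat p q" "P2 \<alpha> * Q2 \<beta> \<in> carrier_mat p q"
      using PP QQ ab by (auto intro!: mult_carrier_mat)
    then have "four_block_mat (A1 \<alpha>) (P1 \<alpha> * Q1 \<beta>) (0\<^sub>m q p) (B1 \<beta>)
        + four_block_mat (A2 \<alpha>) (P2 \<alpha> * Q2 \<beta>) (0\<^sub>m q p) (B2 \<beta>)
      = four_block_mat (A \<alpha>) (P \<alpha> * Q \<beta>) (0\<^sub>m q p) (B \<beta>)"
      using ab A12(3) B12(3) PQ(3) car[of \<alpha>] car'[of \<beta>]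
      by (subst add_four_block_mat[of _ p p _ q _ q]) auto
    then show "mat_eval (p + q)
       (\<lambda>x. four_block_mat (a \<alpha> x) (U \<alpha> x * W \<beta> x) (0\<^sub>m q p) (b \<beta> x)) (RAdd r s)
       = Some (four_block_mat (A \<alpha>) (P \<alpha> * Q \<beta>) (0\<^sub>m q p) (B \<beta>))"
      using 1(3) 2(3) ab by simp
  qed (use PQ(1,2) in \<open>auto simp: add_mult_distrib\<close>)
next
  case (RMul r s)
  define A1 where "A1 = (\<lambda>\<alpha>. the (mat_eval p (a \<alpha>) r))"
  define A2 where "A2 = (\<lambda>\<alpha>. the (mat_eval p (a \<alpha>) s))"
  have A12: "\<forall>\<alpha>\<in>I. mat_eval p (a \<alpha>) r = Some (A1 \<alpha>)"
      "\<forall>\<alpha>\<in>I. mat_eval p (a \<alpha>) s = Some (A2 \<alpha>)" "\<forall>\<alpha>\<in>I. A \<alpha> = A1 \<alpha> * A2 \<alpha>"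
    using RMul.prems(2) unfolding A1_def A2_def by (auto simp: bind_eq_Some_conv)
  define B1 where "B1 = (\<lambda>\<beta>. the (mat_eval q (b \<beta>) r))"
  define B2 where "B2 = (\<lambda>\<beta>. the (mat_eval q (b \<beta>) s))"
  have B12: "\<forall>\<beta>\<in>J. mat_eval q (b \<beta>) r = Some (B1 \<beta>)"
      "\<forall>\<beta>\<in>J. mat_eval q (b \<beta>) s = Some (B2 \<beta>)" "\<forall>\<beta>\<in>J. B \<beta> = B1 \<beta> * B2 \<beta>"
    using RMul.prems(3) unfolding B1_def B2_def by (auto simp: bind_eq_Some_conv)
  have rs: "rvars r \<subseteq> X" "rvars s \<subseteq> X" using RMul.prems(1) by auto
  obtain P1 Q1 where 1: "\<forall>\<alpha>\<in>I. P1 \<alpha> \<in> carrier_mat p (var_leaves r * d)"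
      "\<forall>\<beta>\<in>J. Q1 \<beta> \<in> carrier_mat (var_leaves r * d) q"
      "\<forall>\<alpha>\<in>I. \<forall>\<beta>\<in>J. mat_eval (p + q)
       (\<lambda>x. four_block_mat (a \<alpha> x) (U \<alpha> x * W \<beta> x) (0\<^sub>m q p) (b \<beta> x)) r
       = Some (four_block_mat (A1 \<alpha>) (P1 \<alpha> * Q1 \<beta>) (0\<^sub>m q p) (B1 \<beta>))"
    using RMul.IH(1)[OF rs(1) A12(1) B12(1)] by blast
  obtain P2 Q2 where 2: "\<forall>\<alpha>\<in>I. P2 \<alpha> \<in> carrier_mat p (var_leaves s * d)"
      "\<forall>\<beta>\<in>J. Q2 \<beta> \<in> carrier_mat (var_leaves s * d) q"
      "\<forall>\<alpha>\<in>I. \<forall>\<beta>\<in>J. mat_eval (p + q)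
       (\<lambda>x. four_block_mat (a \<alpha> x) (U \<alpha> x * W \<beta> x) (0\<^sub>m q p) (b \<beta> x)) s
       = Some (four_block_mat (A2 \<alpha>) (P2 \<alpha> * Q2 \<beta>) (0\<^sub>m q p) (B2 \<beta>))"
    using RMul.IH(2)[OF rs(2) A12(2) B12(2)] by blast
  have car: "A1 \<alpha> \<in> carrier_mat p p" "A2 \<alpha> \<in> carrier_mat p p" if "\<alpha> \<in> I" for \<alpha>
    using that a A12 rs by (auto intro: mat_eval_carrier)
  have car': "B1 \<beta> \<in> carrier_mat q q" "B2 \<beta> \<in> carrier_mat q q" if "\<beta> \<in> J" for \<beta>
    using that b B12 rs by (auto intro: mat_eval_carrier)
  \<comment> \<open>\<open>A1\<close> goes into the second left factor and \<open>B2\<close> into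
    the first right factor, so each factor still depends on one index and the inner dimensions
    add.\<close>
  have PP: "\<forall>\<alpha>\<in>I. P1 \<alpha> \<in> carrier_mat p (var_leaves r * d) \<and> A1 \<alpha> * P2 \<alpha> \<in> carrier_mat p (var_leaves s * d)"
    and QQ: "\<forall>\<beta>\<in>J. Q1 \<beta> * B2 \<beta> \<in> carrier_mat (var_leaves r * d) q \<and> Q2 \<beta> \<in> carrier_mat (var_leaves s * d) q"
    using 1(1,2) 2(1,2) car car' by (metis mult_carrier_mat)+
  obtain P Q where PQ: "\<forall>\<alpha>\<in>I. P \<alpha> \<in> carrier_mat p (var_leaves r * d + var_leaves s * d)"
    "\<forall>\<beta>\<in>J. Q \<beta> \<in> carrier_mat (var_leaves r * d + var_leaves s * d) q"
    "\<forall>\<alpha>\<in>I. \<forall>\<beta>\<in>J. P \<alpha> * Q \<beta> = P1 \<alpha> * (Q1 \<beta> * B2 \<beta>) + A1 \<alpha> * P2 \<alpha> * Q2 \<beta>"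
    by (rule append_blocks[OF PP QQ]) blast
  show ?case
  proof (intro exI[of _ P] exI[of _ Q] conjI ballI)
    fix \<alpha> \<beta> assume ab: "\<alpha> \<in> I" "\<beta> \<in> J"
    have C: "P1 \<alpha> * Q1 \<beta> \<in> carrier_mat p q" "P2 \<alpha> * Q2 \<beta> \<in> carrier_mat p q"
      using 1(1,2) 2(1,2) ab by (auto intro!: mult_carrier_mat)
    have PQ': "P \<alpha> * Q \<beta> = A1 \<alpha> * (P2 \<alpha> * Q2 \<beta>) + P1 \<alpha> * Q1 \<beta> * B2 \<beta>"
    proof -
      have "P1 \<alpha> * (Q1 \<beta> * B2 \<beta>) = P1 \<alpha> * Q1 \<beta> * B2 \<beta>"
        using 1(1,2) ab car'[of \<beta>] by (simp add: assoc_mult_mat[of _ p "var_leaves r * d" _ q _ q])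
      moreover have "A1 \<alpha> * P2 \<alpha> * Q2 \<beta> = A1 \<alpha> * (P2 \<alpha> * Q2 \<beta>)"
        using 2(1,2) ab car[of \<alpha>] by (simp add: assoc_mult_mat[of _ p p _ "var_leaves s * d" _ q])
      moreover have c: "P1 \<alpha> * Q1 \<beta> * B2 \<beta> \<in> carrier_mat p q" "A1 \<alpha> * (P2 \<alpha> * Q2 \<beta>) \<in> carrier_mat p q"
        using C ab car[of \<alpha>] car'[of \<beta>] by (auto intro!: mult_carrier_mat)
      ultimately show ?thesis using PQ(3) ab comm_add_mat[OF c] by simp
    qed
    have "four_block_mat (A1 \<alpha>) (P1 \<alpha> * Q1 \<beta>) (0\<^sub>m q p) (B1 \<beta>)
        * four_block_mat (A2 \<alpha>) (P2 \<alpha> * Q2 \<beta>) (0\<^sub>m q p) (B2 \<beta>)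
      = four_block_mat (A \<alpha>) (P \<alpha> * Q \<beta>) (0\<^sub>m q p) (B \<beta>)"
      unfolding PQ' using ab A12(3) B12(3) car[of \<alpha>] car'[of \<beta>] C
      by (subst mult_block_triangular) auto
    then show "mat_eval (p + q)
       (\<lambda>x. four_block_mat (a \<alpha> x) (U \<alpha> x * W \<beta> x) (0\<^sub>m q p) (b \<beta> x)) (RMul r s)
       = Some (four_block_mat (A \<alpha>) (P \<alpha> * Q \<beta>) (0\<^sub>m q p) (B \<beta>))"
      using 1(3) 2(3) ab by simp
  qed (use PQ(1,2) in \<open>auto simp: add_mult_distrib\<close>)
next
  case (RInv r)
  define A1 where "A1 = (\<lambda>\<alpha>. the (mat_eval p (a \<alpha>) r))"
  have A1: "\<forall>\<alpha>\<in>I. mat_eval p (a \<alpha>) r = Some (A1 \<alpha>)"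
      "\<forall>\<alpha>\<in>I. mat_inverse (A1 \<alpha>) = Some (A \<alpha>)"
    using RInv.prems(2) unfolding A1_def by (auto simp: bind_eq_Some_conv)
  define B1 where "B1 = (\<lambda>\<beta>. the (mat_eval q (b \<beta>) r))"
  have B1: "\<forall>\<beta>\<in>J. mat_eval q (b \<beta>) r = Some (B1 \<beta>)"
      "\<forall>\<beta>\<in>J. mat_inverse (B1 \<beta>) = Some (B \<beta>)"
    using RInv.prems(3) unfolding B1_def by (auto simp: bind_eq_Some_conv)
  have rs: "rvars r \<subseteq> X" using RInv.prems(1) by auto
  obtain P Q where 1: "\<forall>\<alpha>\<in>I. P \<alpha> \<in> carrier_mat p (var_leaves r * d)"
      "\<forall>\<beta>\<in>J. Q \<beta> \<in> carrier_mat (var_leaves r * d) q"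
      "\<forall>\<alpha>\<in>I. \<forall>\<beta>\<in>J. mat_eval (p + q)
       (\<lambda>x. four_block_mat (a \<alpha> x) (U \<alpha> x * W \<beta> x) (0\<^sub>m q p) (b \<beta> x)) r
       = Some (four_block_mat (A1 \<alpha>) (P \<alpha> * Q \<beta>) (0\<^sub>m q p) (B1 \<beta>))"
    using RInv.IH[OF rs A1(1) B1(1)] by blast
  have car: "A1 \<alpha> \<in> carrier_mat p p" "A \<alpha> \<in> carrier_mat p p" "A1 \<alpha> * A \<alpha> = 1\<^sub>m p" if "\<alpha> \<in> I" for \<alpha>
  proof -
    show c: "A1 \<alpha> \<in> carrier_mat p p" using that a A1 rs by (auto intro: mat_eval_carrier)
    show "A \<alpha> \<in> carrier_mat p p" "A1 \<alpha> * A \<alpha> = 1\<^sub>m p" using mat_inverse(2)[OF c] A1(2) that by auto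
  qed
  have car': "B1 \<beta> \<in> carrier_mat q q" "B \<beta> \<in> carrier_mat q q" "B1 \<beta> * B \<beta> = 1\<^sub>m q" if "\<beta> \<in> J" for \<beta>
  proof -
    show c: "B1 \<beta> \<in> carrier_mat q q" using that b B1 rs by (auto intro: mat_eval_carrier)
    show "B \<beta> \<in> carrier_mat q q" "B1 \<beta> * B \<beta> = 1\<^sub>m q" using mat_inverse(2)[OF c] B1(2) that by auto
  qed
  \<comment> \<open>Here \<open>A\<close> and \<open>B\<close> are already the inverses of the
    diagonal blocks \<open>A1\<close> and \<open>B1\<close>. The corner
    \<open>- A * (P * Q) * B\<close> of the inverse is regrouped with the sign on the left; the
    inner dimension stays the same.\<close>
  let ?P = "\<lambda>\<alpha>. A \<alpha> * - P \<alpha>" and ?Q = "\<lambda>\<beta>. Q \<beta> * B \<beta>"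
  show ?case
  proof (intro exI[of _ ?P] exI[of _ ?Q] conjI ballI)
    fix \<alpha> \<beta> assume ab: "\<alpha> \<in> I" "\<beta> \<in> J"
    let ?n = "var_leaves r * d"
    have P: "P \<alpha> \<in> carrier_mat p ?n" "- P \<alpha> \<in> carrier_mat p ?n" and Q: "Q \<beta> \<in> carrier_mat ?n q"
      using 1(1,2) ab by auto
    note cc = car[OF ab(1)] car'[OF ab(2)]
    have QB: "Q \<beta> * B \<beta> \<in> carrier_mat ?n q" using Q cc by auto
    have C: "P \<alpha> * Q \<beta> \<in> carrier_mat p q" "?P \<alpha> * ?Q \<beta> \<in> carrier_mat p q"
      using P Q QB cc by (auto intro!: mult_carrier_mat)
    have "A1 \<alpha> * (?P \<alpha> * ?Q \<beta>) = (A1 \<alpha> * A \<alpha>) * (- P \<alpha> * ?Q \<beta>)"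
      using assoc_mult_mat[OF cc(1,2) mult_carrier_mat[OF P(2) QB]]
        assoc_mult_mat[OF cc(2) P(2) QB] by simp
    also have "\<dots> = - (P \<alpha> * Q \<beta> * B \<beta>)"
      using P Q QB C cc by (simp add: uminus_mult_left_mat assoc_mult_mat[OF P(1) Q])
    finally have "A1 \<alpha> * (?P \<alpha> * ?Q \<beta>) + P \<alpha> * Q \<beta> * B \<beta> = 0\<^sub>m p q"
      using C cc by (auto intro!: uminus_l_inv_mat mult_carrier_mat)
    then have "four_block_mat (A1 \<alpha>) (P \<alpha> * Q \<beta>) (0\<^sub>m q p) (B1 \<beta>)
        * four_block_mat (A \<alpha>) (?P \<alpha> * ?Q \<beta>) (0\<^sub>m q p) (B \<beta>) = 1\<^sub>m (p + q)"
      using C cc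
      by (subst mult_block_triangular) auto
    then have "mat_inverse (four_block_mat (A1 \<alpha>) (P \<alpha> * Q \<beta>) (0\<^sub>m q p) (B1 \<beta>))
        = Some (four_block_mat (A \<alpha>) (?P \<alpha> * ?Q \<beta>) (0\<^sub>m q p) (B \<beta>))"
      using C cc by (intro mat_inverse_SomeI) auto
    then show "mat_eval (p + q)
       (\<lambda>x. four_block_mat (a \<alpha> x) (U \<alpha> x * W \<beta> x) (0\<^sub>m q p) (b \<beta> x)) (RInv r)
       = Some (four_block_mat (A \<alpha>) (?P \<alpha> * ?Q \<beta>) (0\<^sub>m q p) (B \<beta>))"
      using 1(3) ab by simp
  qed (use 1(1,2) car car' in \<open>auto intro!: mult_carrier_mat\<close>)
qed

section \<open>Common points of definition\<close>

text \<open>Along a polynomial curve of matrices every expression is a matrix of polynomials over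
  one common denominator \<open>g\<close>, because an inverse is an adjugate over a determinant.
  Since \<open>g\<close> is nonzero at one parameter, the expression can be undefined at finitely
  many parameters only.\<close>

lemma mat_eval_along_curve:
  fixes c :: "'x \<Rightarrow> 'k::field poly mat"
  assumes c: "\<forall>x\<in>X. c x \<in> carrier_mat n n" and r: "rvars r \<subseteq> X"
    and t\<^sub>0: "mat_eval n (\<lambda>x. map_mat (\<lambda>p. poly p t\<^sub>0) (c x)) r \<noteq> None"
  shows "\<exists>g N. N \<in> carrier_mat n n \<and> poly g t\<^sub>0 \<noteq> 0 \<and>
    (\<forall>t. poly g t \<noteq> 0 \<longrightarrow> mat_eval n (\<lambda>x. map_mat (\<lambda>p. poly p t) (c x)) r =
       Some (inverse (poly g t) \<cdot>\<^sub>m map_mat (\<lambda>p. poly p t) N))"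
  using r t\<^sub>0
proof (induction r)
  case (RConst k)
  show ?case
    by (rule exI[of _ 1], rule exI[of _ "[:k:] \<cdot>\<^sub>m 1\<^sub>m n"]) (auto intro!: eq_matI)
next
  case (RVar x)
  then show ?case using c
    by (intro exI[of _ 1], intro exI[of _ "c x"]) (auto intro!: eq_matI)
next
  case (RAdd r s)
  have d: "mat_eval n (\<lambda>x. map_mat (\<lambda>p. poly p t\<^sub>0) (c x)) r \<noteq> None"
    "mat_eval n (\<lambda>x. map_mat (\<lambda>p. poly p t\<^sub>0) (c x)) s \<noteq> None"
    using RAdd.prems(2) by (auto simp: bind_eq_None_conv split: option.splits)
  obtain g N where g: "N \<in> carrier_mat n n" "poly g t\<^sub>0 \<noteq> 0"
     "\<And>t. poly g t \<noteq> 0 \<Longrightarrow> mat_eval n (\<lambda>x. map_mat (\<lambda>p. poly p t) (c x)) r =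
       Some (inverse (poly g t) \<cdot>\<^sub>m map_mat (\<lambda>p. poly p t) N)"
    using RAdd.IH(1)[OF _ d(1)] RAdd.prems(1) by auto
  obtain h M where h: "M \<in> carrier_mat n n" "poly h t\<^sub>0 \<noteq> 0"
     "\<And>t. poly h t \<noteq> 0 \<Longrightarrow> mat_eval n (\<lambda>x. map_mat (\<lambda>p. poly p t) (c x)) s =
       Some (inverse (poly h t) \<cdot>\<^sub>m map_mat (\<lambda>p. poly p t) M)"
    using RAdd.IH(2)[OF _ d(2)] RAdd.prems(1) by auto
  show ?case
  proof (rule exI[of _ "g * h"], rule exI[of _ "h \<cdot>\<^sub>m N + g \<cdot>\<^sub>m M"], intro conjI allI impI)
    fix t assume t: "poly (g * h) t \<noteq> 0"
    then have "inverse (poly g t) \<cdot>\<^sub>m map_mat (\<lambda>p. poly p t) N + inverse (poly h t) \<cdot>\<^sub>m map_mat (\<lambda>p. poly p t) M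
      = inverse (poly (g * h) t) \<cdot>\<^sub>m map_mat (\<lambda>p. poly p t) (h \<cdot>\<^sub>m N + g \<cdot>\<^sub>m M)"
      using g(1) h(1) by (intro eq_matI) (auto simp: field_simps)
    with t g(3)[of t] h(3)[of t] show "mat_eval n (\<lambda>x. map_mat (\<lambda>p. poly p t) (c x)) (RAdd r s) =
       Some (inverse (poly (g * h) t) \<cdot>\<^sub>m map_mat (\<lambda>p. poly p t) (h \<cdot>\<^sub>m N + g \<cdot>\<^sub>m M))"
      by auto
  qed (use g(1,2) h(1,2) in auto)
next
  case (RMul r s)
  have d: "mat_eval n (\<lambda>x. map_mat (\<lambda>p. poly p t\<^sub>0) (c x)) r \<noteq> None"
    "mat_eval n (\<lambda>x. map_mat (\<lambda>p. poly p t\<^sub>0) (c x)) s \<noteq> None"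
    using RMul.prems(2) by (auto simp: bind_eq_None_conv split: option.splits)
  obtain g N where g: "N \<in> carrier_mat n n" "poly g t\<^sub>0 \<noteq> 0"
     "\<And>t. poly g t \<noteq> 0 \<Longrightarrow> mat_eval n (\<lambda>x. map_mat (\<lambda>p. poly p t) (c x)) r =
       Some (inverse (poly g t) \<cdot>\<^sub>m map_mat (\<lambda>p. poly p t) N)"
    using RMul.IH(1)[OF _ d(1)] RMul.prems(1) by auto
  obtain h M where h: "M \<in> carrier_mat n n" "poly h t\<^sub>0 \<noteq> 0"
     "\<And>t. poly h t \<noteq> 0 \<Longrightarrow> mat_eval n (\<lambda>x. map_mat (\<lambda>p. poly p t) (c x)) s =
       Some (inverse (poly h t) \<cdot>\<^sub>m map_mat (\<lambda>p. poly p t) M)"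
    using RMul.IH(2)[OF _ d(2)] RMul.prems(1) by auto
  show ?case
  proof (rule exI[of _ "g * h"], rule exI[of _ "N * M"], intro conjI allI impI)
    fix t assume t: "poly (g * h) t \<noteq> 0"
    interpret ev: comm_ring_hom "\<lambda>p. poly p t" by unfold_locales auto
    have smult_smult: "k \<cdot>\<^sub>m (l \<cdot>\<^sub>m Z) = (k * l) \<cdot>\<^sub>m Z" for k l and Z :: "'k mat"
      by (intro eq_matI) (auto simp: mult.assoc)
    have "inverse (poly g t) \<cdot>\<^sub>m map_mat (\<lambda>p. poly p t) N * (inverse (poly h t) \<cdot>\<^sub>m map_mat (\<lambda>p. poly p t) M)
      = inverse (poly (g * h) t) \<cdot>\<^sub>m map_mat (\<lambda>p. poly p t) (N * M)"
      unfolding ev.mat_hom_mult[OF g(1) h(1)] using g(1) h(1)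
      by (simp add: mult_smult_assoc_mat[of _ n n _ n] mult_smult_distrib[of _ n n _ n] smult_smult mult.commute)
    with t g(3)[of t] h(3)[of t] show "mat_eval n (\<lambda>x. map_mat (\<lambda>p. poly p t) (c x)) (RMul r s) =
       Some (inverse (poly (g * h) t) \<cdot>\<^sub>m map_mat (\<lambda>p. poly p t) (N * M))"
      by auto
  qed (use g(1,2) h(1,2) in auto)
next
  case (RInv r)
  have d: "mat_eval n (\<lambda>x. map_mat (\<lambda>p. poly p t\<^sub>0) (c x)) r \<noteq> None"
    by (rule contrapos_nn[OF RInv.prems(2)]) simp
  obtain g N where g: "N \<in> carrier_mat n n" "poly g t\<^sub>0 \<noteq> 0"
     "\<And>t. poly g t \<noteq> 0 \<Longrightarrow> mat_eval n (\<lambda>x. map_mat (\<lambda>p. poly p t) (c x)) r =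
       Some (inverse (poly g t) \<cdot>\<^sub>m map_mat (\<lambda>p. poly p t) N)"
    using RInv.IH[OF _ d] RInv.prems(1) by auto
  define V where "V t = inverse (poly g t) \<cdot>\<^sub>m map_mat (\<lambda>p. poly p t) N" for t
  have V: "V t \<in> carrier_mat n n" for t unfolding V_def using g(1) by auto
  have hom_det: "det (map_mat (\<lambda>p. poly p t) N) = poly (det N) t" for t
  proof -
    interpret ev: comm_ring_hom "\<lambda>p. poly p t" by unfold_locales auto
    show ?thesis by (rule ev.hom_det)
  qed
  obtain B where "mat_inverse (V t\<^sub>0) = Some B"
    using RInv.prems(2) g(3)[OF g(2)] unfolding V_def by auto
  then have "V t\<^sub>0 * B = 1\<^sub>m n" "B \<in> carrier_mat n n" using mat_inverse(2)[OF V] by auto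
  then have "det (V t\<^sub>0) \<noteq> 0" using det_mult[OF V, of B t\<^sub>0] by auto
  then have det0: "poly (det N) t\<^sub>0 \<noteq> 0" unfolding V_def by (simp add: hom_det)
  note adj = adj_mat[OF g(1)]
  \<comment> \<open>The inverse of \<open>N / g\<close> is \<open>g * adj N / det N\<close>.
    Expanding by another \<open>g\<close> makes the denominator \<open>g * det N\<close>, whose
    nonvanishing also ensures that \<open>r\<close> itself is defined with value
    \<open>V t\<close>.\<close>
  let ?M = "(g * g) \<cdot>\<^sub>m adj_mat N"
  show ?case
  proof (rule exI[of _ "g * det N"], rule exI[of _ ?M], intro conjI allI impI)
    fix t assume t: "poly (g * det N) t \<noteq> 0"
    interpret ev: comm_ring_hom "\<lambda>p. poly p t" by unfold_locales auto
    let ?B = "inverse (poly (g * det N) t) \<cdot>\<^sub>m map_mat (\<lambda>p. poly p t) ?M"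
    have "map_mat (\<lambda>p. poly p t) N * map_mat (\<lambda>p. poly p t) (adj_mat N)
      = map_mat (\<lambda>p. poly p t) (det N \<cdot>\<^sub>m 1\<^sub>m n)"
      using ev.mat_hom_mult[OF g(1) adj(1)] adj(2) by simp
    also have "\<dots> = poly (det N) t \<cdot>\<^sub>m 1\<^sub>m n" by (auto intro!: eq_matI)
    finally have *: "map_mat (\<lambda>p. poly p t) N * map_mat (\<lambda>p. poly p t) (adj_mat N)
      = poly (det N) t \<cdot>\<^sub>m 1\<^sub>m n" .
    have "?B = (poly g t * inverse (poly (det N) t)) \<cdot>\<^sub>m map_mat (\<lambda>p. poly p t) (adj_mat N)"
      using adj(1) t by (intro eq_matI) (auto simp: field_simps)
    then have "V t * ?B = inverse (poly g t) \<cdot>\<^sub>m ((poly g t * inverse (poly (det N) t)) \<cdot>\<^sub>m (poly (det N) t \<cdot>\<^sub>m 1\<^sub>m n))"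
      unfolding V_def using g(1) adj(1) *
      by (simp add: mult_smult_assoc_mat[of _ n n _ n] mult_smult_distrib[of _ n n _ n], intro eq_matI)
        auto
    also have "\<dots> = 1\<^sub>m n" using t by (intro eq_matI) auto
    finally have "mat_inverse (V t) = Some ?B"
      using V adj(1) by (intro mat_inverse_SomeI) auto
    with t g(3)[of t] show "mat_eval n (\<lambda>x. map_mat (\<lambda>p. poly p t) (c x)) (RInv r) = Some ?B"
      unfolding V_def by simp
  qed (use g(1,2) det0 adj(1) in auto)
qed

text \<open>Block diagonal repetition of \<open>a\<close>, seen as block triangular with inner
  dimension 0. A single \<open>a'\<close> serves all expressions, and the value at \<open>a\<close>
  survives as the upper left corner, which is enough to tell two values apart.\<close>

lemma blow_up_point:
  fixes a :: "'x \<Rightarrow> 'k::field mat"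
  assumes a: "a \<in> mat_points X n"
  shows "\<exists>a'\<in>mat_points X (n * Suc m). \<forall>r A. rvars r \<subseteq> X \<longrightarrow> mat_eval n a r = Some A \<longrightarrow>
    (\<exists>A'. mat_eval (n * Suc m) a' r = Some A' \<and> (\<forall>i<n. \<forall>j<n. A' $$ (i, j) = A $$ (i, j)))"
proof (induction m)
  case 0
  show ?case using a by auto
next
  case (Suc m)
  let ?q = "n * Suc m"
  obtain b where b: "b \<in> mat_points X ?q"
    and ev: "\<And>r A. rvars r \<subseteq> X \<Longrightarrow> mat_eval n a r = Some A \<Longrightarrow>
    (\<exists>A'. mat_eval ?q b r = Some A' \<and> (\<forall>i<n. \<forall>j<n. A' $$ (i, j) = A $$ (i, j)))"
    using Suc by blast
  let ?e = "\<lambda>x. four_block_mat (a x) (0\<^sub>m n 0 * 0\<^sub>m 0 ?q) (0\<^sub>m ?q n) (b x)"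
  show ?case
  proof (rule bexI[of _ ?e], intro allI impI)
    fix r A assume r: "rvars r \<subseteq> X" and A: "mat_eval n a r = Some A"
    obtain B where B: "mat_eval ?q b r = Some B" using ev[OF r A] by blast
    obtain C where C: "mat_eval (n + ?q) ?e r = Some (four_block_mat A C (0\<^sub>m ?q n) B)"
      using mat_eval_block_triangular[of "{()}" "\<lambda>_. a" X n "{()}" "\<lambda>_. b" ?q "\<lambda>_ _. 0\<^sub>m n 0" 0
          "\<lambda>_ _. 0\<^sub>m 0 ?q" r "\<lambda>_. A" "\<lambda>_. B"] a b r A B by auto
    have "A \<in> carrier_mat n n" "B \<in> carrier_mat ?q ?q"
      using mat_eval_carrier r a A b B by blast+
    then show "\<exists>A'. mat_eval (n * Suc (Suc m)) ?e r = Some A' \<and> (\<forall>i<n. \<forall>j<n. A' $$ (i, j) = A $$ (i, j))"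
      using C by auto
  next
    show "?e \<in> mat_points X (n * Suc (Suc m))"
      using a b by (auto simp: mat_points_def)
  qed
qed

text \<open>Points of sizes \<open>n\<close> and \<open>m\<close> are both enlarged to size
  \<open>n * m\<close> and joined by a line; each expression fails at finitely many parameters on
  it, and an infinite field has another one. The last clause, that a disagreement of
  \<open>r\<close> and \<open>r'\<close> persists, is there for the transitivity of
  \<open>rexp_rel\<close>.\<close>

lemma common_point:
  fixes a b :: "'x \<Rightarrow> 'k::field mat"
  assumes inf: "infinite (UNIV :: 'k set)"
    and a: "a \<in> mat_points X n" "n > 0" and b: "b \<in> mat_points X m" "m > 0"
    and X: "rvars r \<subseteq> X" "rvars r' \<subseteq> X" "rvars s \<subseteq> X"
    and A: "mat_eval n a r = Some A" "mat_eval n a r' = Some A'" and B: "mat_eval m b s = Some B"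
  obtains l e C C' D where "l > 0" "e \<in> mat_points X l" "mat_eval l e r = Some C"
    "mat_eval l e r' = Some C'" "mat_eval l e s = Some D" "A \<noteq> A' \<Longrightarrow> C \<noteq> C'"
proof -
  let ?l = "n * m"
  obtain a' where a': "a' \<in> mat_points X ?l"
    and eva: "\<And>r A. rvars r \<subseteq> X \<Longrightarrow> mat_eval n a r = Some A \<Longrightarrow>
    (\<exists>A'. mat_eval ?l a' r = Some A' \<and> (\<forall>i<n. \<forall>j<n. A' $$ (i, j) = A $$ (i, j)))"
    using blow_up_point[OF a(1), of "m - 1"] b(2) by auto
  obtain b' where b': "b' \<in> mat_points X ?l"
    and evb: "\<And>r A. rvars r \<subseteq> X \<Longrightarrow> mat_eval m b r = Some A \<Longrightarrow>
    (\<exists>A'. mat_eval ?l b' r = Some A')"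
    using blow_up_point[OF b(1), of "n - 1"] a(2) by (fastforce simp: mult.commute)
  obtain C where C: "mat_eval ?l a' r = Some C" "\<forall>i<n. \<forall>j<n. C $$ (i, j) = A $$ (i, j)"
    using eva[OF X(1) A(1)] by blast
  obtain C' where C': "mat_eval ?l a' r' = Some C'" "\<forall>i<n. \<forall>j<n. C' $$ (i, j) = A' $$ (i, j)"
    using eva[OF X(2) A(2)] by blast
  obtain D where D: "mat_eval ?l b' s = Some D" using evb[OF X(3) B] by blast
  have AA: "A \<in> carrier_mat n n" "A' \<in> carrier_mat n n"
    using mat_eval_carrier X a A by blast+
  define c where "c x = mat ?l ?l (\<lambda>ij. [:a' x $$ ij, b' x $$ ij - a' x $$ ij:])" for x
  define e where "e t x = map_mat (\<lambda>p. poly p t) (c x)" for t :: 'k and x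
  have c: "\<forall>x\<in>X. c x \<in> carrier_mat ?l ?l" unfolding c_def by auto
  have pts: "e t \<in> mat_points X ?l" for t using c unfolding e_def by (auto simp: mat_points_def)
  have e0: "\<forall>x\<in>X. e 0 x = a' x" and e1: "\<forall>x\<in>X. e 1 x = b' x"
    using a' b' unfolding e_def c_def mat_points_def by (auto intro!: eq_matI)
  have "mat_eval ?l (e 0) r \<noteq> None" "mat_eval ?l (e 0) r' \<noteq> None" "mat_eval ?l (e 1) s \<noteq> None"
    using C C' D mat_eval_cong[OF X(1) e0] mat_eval_cong[OF X(2) e0] mat_eval_cong[OF X(3) e1] by auto
  obtain g N where g: "N \<in> carrier_mat ?l ?l" "poly g 0 \<noteq> 0"
    "\<And>t. poly g t \<noteq> 0 \<Longrightarrow> mat_eval ?l (e t) r = Some (inverse (poly g t) \<cdot>\<^sub>m map_mat (\<lambda>p. poly p t) N)"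
    using mat_eval_along_curve[OF c X(1), of 0] \<open>mat_eval ?l (e 0) r \<noteq> None\<close> unfolding e_def by blast
  obtain g' N' where g': "N' \<in> carrier_mat ?l ?l" "poly g' 0 \<noteq> 0"
    "\<And>t. poly g' t \<noteq> 0 \<Longrightarrow> mat_eval ?l (e t) r' = Some (inverse (poly g' t) \<cdot>\<^sub>m map_mat (\<lambda>p. poly p t) N')"
    using mat_eval_along_curve[OF c X(2), of 0] \<open>mat_eval ?l (e 0) r' \<noteq> None\<close> unfolding e_def by blast
  obtain h M where h: "M \<in> carrier_mat ?l ?l" "poly h 1 \<noteq> 0"
    "\<And>t. poly h t \<noteq> 0 \<Longrightarrow> mat_eval ?l (e t) s = Some (inverse (poly h t) \<cdot>\<^sub>m map_mat (\<lambda>p. poly p t) M)"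
    using mat_eval_along_curve[OF c X(3), of 1] \<open>mat_eval ?l (e 1) s \<noteq> None\<close> unfolding e_def by blast
  have C_eq: "C = inverse (poly g 0) \<cdot>\<^sub>m map_mat (\<lambda>p. poly p 0) N"
    using g(3)[OF g(2)] C(1) mat_eval_cong[OF X(1) e0] by simp
  have C'_eq: "C' = inverse (poly g' 0) \<cdot>\<^sub>m map_mat (\<lambda>p. poly p 0) N'"
    using g'(3)[OF g'(2)] C'(1) mat_eval_cong[OF X(2) e0] by simp
  have le: "i < n \<Longrightarrow> i < ?l" for i using b(2) by (metis less_le_trans mult.right_neutral mult_le_mono2 Suc_leI One_nat_def)
  \<comment> \<open>\<open>f\<close> is the cross-multiplied difference of one entry in which the
    two values differ at \<open>t = 0\<close>; where it does not vanish, they still differ. If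
    \<open>A = A'\<close> there is no disagreement to preserve and \<open>f = 1\<close> will
    do.\<close>
  obtain f where f: "f \<noteq> 0" "\<And>t. poly g t \<noteq> 0 \<Longrightarrow> poly g' t \<noteq> 0 \<Longrightarrow> poly f t \<noteq> 0 \<Longrightarrow> A \<noteq> A' \<Longrightarrow>
     inverse (poly g t) \<cdot>\<^sub>m map_mat (\<lambda>p. poly p t) N \<noteq> inverse (poly g' t) \<cdot>\<^sub>m map_mat (\<lambda>p. poly p t) N'"
  proof (cases "A = A'")
    case True
    then show ?thesis using that[of 1] by simp
  next
    case False
    then obtain i j where ij: "i < n" "j < n" "A $$ (i, j) \<noteq> A' $$ (i, j)"
      using AA eq_matI[of A A'] by (metis carrier_matD)
    let ?f = "N $$ (i, j) * g' - N' $$ (i, j) * g"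
    have *: "(inverse (poly g t) \<cdot>\<^sub>m map_mat (\<lambda>p. poly p t) N) $$ (i, j) =
       (inverse (poly g' t) \<cdot>\<^sub>m map_mat (\<lambda>p. poly p t) N') $$ (i, j) \<longleftrightarrow> poly ?f t = 0"
      if "poly g t \<noteq> 0" "poly g' t \<noteq> 0" for t
      using that g(1) g'(1) le[OF ij(1)] le[OF ij(2)] by (auto simp: field_simps)
    have "C $$ (i, j) \<noteq> C' $$ (i, j)" using C(2) C'(2) ij by simp
    then have "poly ?f 0 \<noteq> 0" using *[OF g(2) g'(2)] unfolding C_eq C'_eq by blast
    then have "?f \<noteq> 0" by (metis poly_0)
    with * show ?thesis using that[of ?f] by metis
  qed
  have "f * g * g' * h \<noteq> 0" using f(1) g(2) g'(2) h(2) by auto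
  then have "finite {t. poly (f * g * g' * h) t = 0}" by (rule poly_roots_finite)
  then obtain t where t: "poly (f * g * g' * h) t \<noteq> 0"
    using inf by (metis (mono_tags, lifting) UNIV_eq_I mem_Collect_eq)
  show ?thesis
    by (rule that[OF _ pts g(3) g'(3) h(3) f(2), of t]) (use t a(2) b(2) in auto)
qed

section \<open>Operations on classes of expressions\<close>

lemma nondegenerateE:
  assumes "r \<in> nondegenerate X"
  obtains n a A where "rvars r \<subseteq> X" "n > 0" "a \<in> mat_points X n" "mat_eval n a r = Some A"
    "A \<in> carrier_mat n n"
  using assms unfolding nondegenerate_def by (blast intro: mat_eval_carrier)

lemma nondegenerate_RConst: "RConst c \<in> nondegenerate X"
  unfolding nondegenerate_def
  by (auto intro!: exI[of _ "1::nat"] bexI[of _ "\<lambda>_. 1\<^sub>m 1"] simp: mat_points_def)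

lemma nondegenerate_RVar: "x \<in> X \<Longrightarrow> RVar x \<in> nondegenerate X"
  unfolding nondegenerate_def
  by (auto intro!: exI[of _ "1::nat"] bexI[of _ "\<lambda>_. 1\<^sub>m 1"] simp: mat_points_def)

lemma rexp_relI:
  assumes "r \<in> nondegenerate X" "s \<in> nondegenerate X"
    and "\<And>n a A B. n > 0 \<Longrightarrow> a \<in> mat_points X n \<Longrightarrow> mat_eval n a r = Some A \<Longrightarrow>
      mat_eval n a s = Some B \<Longrightarrow> A = B"
  shows "(r, s) \<in> rexp_rel X"
  using assms unfolding rexp_rel_def by blast

lemma rexp_relD:
  assumes "(r, s) \<in> rexp_rel X" "n > 0" "a \<in> mat_points X n"
    "mat_eval n a r = Some A" "mat_eval n a s = Some B"
  shows "A = B"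
  using assms unfolding rexp_rel_def by blast

lemma rexp_rel_nondegenerate:
  "(r, s) \<in> rexp_rel X \<Longrightarrow> r \<in> nondegenerate X" "(r, s) \<in> rexp_rel X \<Longrightarrow> s \<in> nondegenerate X"
  unfolding rexp_rel_def by auto

lemma rexp_class_mem: "r \<in> nondegenerate X \<Longrightarrow> r \<in> rexp_class X r"
  unfolding rexp_class_def by (auto intro!: rexp_relI)

lemma carrier_free_skew_field:
  "carrier (free_skew_field X) = rexp_class X ` nondegenerate X"
  unfolding free_skew_field_def quotient_def rexp_class_def by auto

lemma one_free_skew_field: "\<one>\<^bsub>free_skew_field X\<^esub> = rexp_class X (RConst 1)"
  and zero_free_skew_field: "\<zero>\<^bsub>free_skew_field X\<^esub> = rexp_class X (RConst 0)"
  unfolding free_skew_field_def by auto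

context
  fixes X :: "'x set"
  assumes inf: "infinite (UNIV :: 'k::field set)"
begin

lemma common_nondegenerate_point:
  fixes r s :: "('k, 'x) rexp"
  assumes "r \<in> nondegenerate X" "s \<in> nondegenerate X"
  obtains n a A B where "n > 0" "a \<in> mat_points X n" "mat_eval n a r = Some A"
    "mat_eval n a s = Some B"
proof -
  obtain n a A where 1: "rvars r \<subseteq> X" "n > 0" "a \<in> mat_points X n" "mat_eval n a r = Some A"
    by (rule nondegenerateE[OF assms(1)])
  obtain m b B where 2: "rvars s \<subseteq> X" "m > 0" "b \<in> mat_points X m" "mat_eval m b s = Some B"
    by (rule nondegenerateE[OF assms(2)])
  show ?thesis
    by (rule common_point[OF inf 1(3,2) 2(3,2) 1(1,1) 2(1) 1(4,4) 2(4)]) (rule that)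
qed

lemma nondegenerate_RAdd:
  fixes r s :: "('k, 'x) rexp"
  assumes "r \<in> nondegenerate X" "s \<in> nondegenerate X"
  shows "RAdd r s \<in> nondegenerate X"
proof (rule common_nondegenerate_point[OF assms])
  fix n a A B assume "n > 0" "a \<in> mat_points X n" "mat_eval n a r = Some A" "mat_eval n a s = Some B"
  moreover have "rvars r \<subseteq> X" "rvars s \<subseteq> X" using assms unfolding nondegenerate_def by auto
  ultimately show ?thesis
    unfolding nondegenerate_def by (auto intro!: exI[of _ n] bexI[of _ a])
qed

lemma nondegenerate_RMul:
  fixes r s :: "('k, 'x) rexp"
  assumes "r \<in> nondegenerate X" "s \<in> nondegenerate X"
  shows "RMul r s \<in> nondegenerate X"
proof (rule common_nondegenerate_point[OF assms])
  fix n a A B assume "n > 0" "a \<in> mat_points X n" "mat_eval n a r = Some A" "mat_eval n a s = Some B"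
  moreover have "rvars r \<subseteq> X" "rvars s \<subseteq> X" using assms unfolding nondegenerate_def by auto
  ultimately show ?thesis
    unfolding nondegenerate_def by (auto intro!: exI[of _ n] bexI[of _ a])
qed

text \<open>Transitivity is the real content: \<open>s\<close> may be undefined at a point where
  \<open>r\<close> and \<open>t\<close> are defined and disagree. \<open>common_point\<close> moves
  the disagreement to a point where all three are defined.\<close>

lemma equiv_rexp_rel: "equiv (nondegenerate X) (rexp_rel X :: (('k, 'x) rexp \<times> ('k, 'x) rexp) set)"
proof (rule equivI)
  show "trans (rexp_rel X :: (('k, 'x) rexp \<times> ('k, 'x) rexp) set)"
  proof (rule transI, rule rexp_relI)
    fix r s t :: "('k, 'x) rexp" and n a A A'
    assume rs: "(r, s) \<in> rexp_rel X" and st: "(s, t) \<in> rexp_rel X"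
    show "r \<in> nondegenerate X" "t \<in> nondegenerate X"
      using rexp_rel_nondegenerate rs st by blast+
    then have X: "rvars r \<subseteq> X" "rvars t \<subseteq> X" unfolding nondegenerate_def by auto
    assume a: "n > 0" "a \<in> mat_points X n" and A: "mat_eval n a r = Some A" "mat_eval n a t = Some A'"
    obtain m b B where s: "rvars s \<subseteq> X" "m > 0" "b \<in> mat_points X m" "mat_eval m b s = Some B"
      by (rule nondegenerateE[OF rexp_rel_nondegenerate(2)[OF rs]])
    show "A = A'"
    proof (rule common_point[OF inf a(2,1) s(3,2) X s(1) A s(4)], rule ccontr)
      fix l e C C' D assume "0 < l" "e \<in> mat_points X l" "mat_eval l e r = Some C"
        "mat_eval l e t = Some C'" "mat_eval l e s = Some D" "A \<noteq> A' \<Longrightarrow> C \<noteq> C'" "A \<noteq> A'"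
      then show False using rexp_relD[OF rs, of l e C D] rexp_relD[OF st, of l e D C'] by simp
    qed
  qed
qed (auto simp: refl_on_def sym_def rexp_rel_def)

lemma rexp_class_eq_iff:
  fixes r s :: "('k, 'x) rexp"
  assumes "r \<in> nondegenerate X" "s \<in> nondegenerate X"
  shows "rexp_class X r = rexp_class X s \<longleftrightarrow> (r, s) \<in> rexp_rel X"
  unfolding rexp_class_def using eq_equiv_class_iff[OF equiv_rexp_rel assms] .

lemma rexp_class_eqI:
  fixes r s :: "('k, 'x) rexp"
  assumes "r \<in> nondegenerate X" "s \<in> nondegenerate X"
    and "\<And>n a A B. n > 0 \<Longrightarrow> a \<in> mat_points X n \<Longrightarrow> mat_eval n a r = Some A \<Longrightarrow>
      mat_eval n a s = Some B \<Longrightarrow> A = B"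
  shows "rexp_class X r = rexp_class X s"
  unfolding rexp_class_eq_iff[OF assms(1,2)]
  by (rule rexp_relI[OF assms(1,2)]) (rule assms(3))

text \<open>The operations of \<open>free_skew_field\<close> are unions over all representatives.
  The classes united all coincide, and there is at least one, so the union is a single
  class.\<close>

lemma add_rexp_class:
  fixes r s :: "('k, 'x) rexp"
  assumes "r \<in> nondegenerate X" "s \<in> nondegenerate X"
  shows "rexp_class X r \<oplus>\<^bsub>free_skew_field X\<^esub> rexp_class X s = rexp_class X (RAdd r s)"
proof -
  have same: "rexp_class X (RAdd r' s') = rexp_class X (RAdd r s)"
    if "r' \<in> rexp_class X r" "s' \<in> rexp_class X s" for r' s'
  proof -
    from that have rel: "(r, r') \<in> rexp_rel X" "(s, s') \<in> rexp_rel X"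
      unfolding rexp_class_def by auto
    show ?thesis
    proof (rule rexp_class_eqI)
      fix n a A B assume a: "n > 0" "a \<in> mat_points X n"
        and "mat_eval n a (RAdd r' s') = Some A" "mat_eval n a (RAdd r s) = Some B"
      then show "A = B" using rexp_relD[OF rel(1) a] rexp_relD[OF rel(2) a]
        by (auto simp: bind_eq_Some_conv)
    qed (use rel in \<open>auto intro!: nondegenerate_RAdd dest: rexp_rel_nondegenerate\<close>)
  qed
  have "rexp_class X r \<oplus>\<^bsub>free_skew_field X\<^esub> rexp_class X s
      = (\<Union>r'\<in>rexp_class X r. \<Union>s'\<in>rexp_class X s. rexp_class X (RAdd r' s'))"
    by (simp add: free_skew_field_def)
  also have "\<dots> = (\<Union>r'\<in>rexp_class X r. \<Union>s'\<in>rexp_class X s. rexp_class X (RAdd r s))"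
    by (intro SUP_cong refl same)
  also have "\<dots> = rexp_class X (RAdd r s)"
    using rexp_class_mem[OF assms(1)] rexp_class_mem[OF assms(2)] by blast
  finally show ?thesis .
qed

lemma mult_rexp_class:
  fixes r s :: "('k, 'x) rexp"
  assumes "r \<in> nondegenerate X" "s \<in> nondegenerate X"
  shows "rexp_class X r \<otimes>\<^bsub>free_skew_field X\<^esub> rexp_class X s = rexp_class X (RMul r s)"
proof -
  have same: "rexp_class X (RMul r' s') = rexp_class X (RMul r s)"
    if "r' \<in> rexp_class X r" "s' \<in> rexp_class X s" for r' s'
  proof -
    from that have rel: "(r, r') \<in> rexp_rel X" "(s, s') \<in> rexp_rel X"
      unfolding rexp_class_def by auto
    show ?thesis
    proof (rule rexp_class_eqI)
      fix n a A B assume a: "n > 0" "a \<in> mat_points X n"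
        and "mat_eval n a (RMul r' s') = Some A" "mat_eval n a (RMul r s) = Some B"
      then show "A = B" using rexp_relD[OF rel(1) a] rexp_relD[OF rel(2) a]
        by (auto simp: bind_eq_Some_conv)
    qed (use rel in \<open>auto intro!: nondegenerate_RMul dest: rexp_rel_nondegenerate\<close>)
  qed
  have "rexp_class X r \<otimes>\<^bsub>free_skew_field X\<^esub> rexp_class X s
      = (\<Union>r'\<in>rexp_class X r. \<Union>s'\<in>rexp_class X s. rexp_class X (RMul r' s'))"
    by (simp add: free_skew_field_def)
  also have "\<dots> = (\<Union>r'\<in>rexp_class X r. \<Union>s'\<in>rexp_class X s. rexp_class X (RMul r s))"
    by (intro SUP_cong refl same)
  also have "\<dots> = rexp_class X (RMul r s)"
    using rexp_class_mem[OF assms(1)] rexp_class_mem[OF assms(2)] by blast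
  finally show ?thesis .
qed

text \<open>An inverse class provides \<open>s\<close> with \<open>r * s = 1\<close> wherever both
  are defined. At any point where \<open>RMul r s\<close> is defined the value of \<open>r\<close>
  is therefore an invertible matrix, so \<open>RInv r\<close> is defined there.\<close>

lemma inv_rexp_class:
  fixes r :: "('k, 'x) rexp"
  assumes r: "r \<in> nondegenerate X" and unit: "rexp_class X r \<in> Units (free_skew_field X)"
  shows "RInv r \<in> nondegenerate X"
    and "inv\<^bsub>free_skew_field X\<^esub> rexp_class X r = rexp_class X (RInv r)"
proof -
  let ?F = "free_skew_field X :: ('k, 'x) rexp set ring"
  have rX: "rvars r \<subseteq> X" using r unfolding nondegenerate_def by auto
  have inverse: "B = A'" if a: "n > 0" "a \<in> mat_points X n" and "(RMul r s, RConst 1) \<in> rexp_rel X"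
    "mat_eval n a r = Some A" "mat_inverse A = Some B" "mat_eval n a s = Some A'" "rvars s \<subseteq> X"
    for n a A B A' s
  proof -
    have c: "A \<in> carrier_mat n n" "A' \<in> carrier_mat n n" using mat_eval_carrier rX a that by blast+
    have "mat_eval n a (RMul r s) = Some (A * A')" using that by simp
    from rexp_relD[OF that(3) a this] have "A * A' = 1\<^sub>m n" by auto
    then show ?thesis using mat_inverse_SomeI[OF c] that by simp
  qed
  obtain s where s: "s \<in> nondegenerate X" "rexp_class X r \<otimes>\<^bsub>?F\<^esub> rexp_class X s = \<one>\<^bsub>?F\<^esub>"
    using unit unfolding Units_def carrier_free_skew_field by auto
  have rs: "RMul r s \<in> nondegenerate X" using nondegenerate_RMul r s by blast
  have 1: "(RMul r s, RConst 1) \<in> rexp_rel X"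
    using s rs by (simp add: one_free_skew_field mult_rexp_class[OF r s(1)] nondegenerate_RConst
        flip: rexp_class_eq_iff)
  show nd: "RInv r \<in> nondegenerate X"
  proof (rule nondegenerateE[OF rs])
    fix n a C assume a: "n > 0" "a \<in> mat_points X n" and C: "mat_eval n a (RMul r s) = Some C"
      and X: "rvars (RMul r s) \<subseteq> X"
    then obtain A B where AB: "mat_eval n a r = Some A" "mat_eval n a s = Some B" "C = A * B"
      by (auto simp: bind_eq_Some_conv)
    have "A \<in> carrier_mat n n" "B \<in> carrier_mat n n" using mat_eval_carrier a X AB by auto
    moreover have "A * B = 1\<^sub>m n" using rexp_relD[OF 1 a C] AB(3) by auto
    ultimately have "mat_inverse A = Some B" by (rule mat_inverse_SomeI)
    with a AB(1) rX show ?thesis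
      unfolding nondegenerate_def by (auto intro!: exI[of _ n] bexI[of _ a])
  qed
  have mult1: "(RMul r (RInv r), RConst 1) \<in> rexp_rel X" "(RMul (RInv r) r, RConst 1) \<in> rexp_rel X"
  proof -
    have *: "A * B = 1\<^sub>m n \<and> B * A = 1\<^sub>m n" if "a \<in> mat_points X n" "mat_eval n a r = Some A"
      "mat_inverse A = Some B" for n a A B
      using mat_inverse(2) mat_eval_carrier[OF rX] that by blast
    show "(RMul r (RInv r), RConst 1) \<in> rexp_rel X" "(RMul (RInv r) r, RConst 1) \<in> rexp_rel X"
      by (rule rexp_relI; use r nd * in
          \<open>auto intro!: nondegenerate_RMul nondegenerate_RConst simp: bind_eq_Some_conv\<close>)+
  qed
  show "inv\<^bsub>?F\<^esub> rexp_class X r = rexp_class X (RInv r)"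
    \<comment> \<open>\<open>m_inv\<close> is a definite description, so uniqueness has to be shown
      as well: any right inverse agrees with \<open>RInv r\<close> at common points, since a matrix
      has only one inverse.\<close>
    unfolding m_inv_def
  proof (rule the_equality)
    show "rexp_class X (RInv r) \<in> carrier ?F \<and> rexp_class X r \<otimes>\<^bsub>?F\<^esub> rexp_class X (RInv r) = \<one>\<^bsub>?F\<^esub> \<and>
      rexp_class X (RInv r) \<otimes>\<^bsub>?F\<^esub> rexp_class X r = \<one>\<^bsub>?F\<^esub>"
      using mult1 r nd nondegenerate_RMul[OF r nd] nondegenerate_RMul[OF nd r]
      by (simp add: carrier_free_skew_field one_free_skew_field mult_rexp_class rexp_class_eq_iff
          nondegenerate_RConst)
  next
    fix P assume P: "P \<in> carrier ?F \<and> rexp_class X r \<otimes>\<^bsub>?F\<^esub> P = \<one>\<^bsub>?F\<^esub> \<and> P \<otimes>\<^bsub>?F\<^esub> rexp_class X r = \<one>\<^bsub>?F\<^esub>"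
    then obtain t where t: "t \<in> nondegenerate X" "P = rexp_class X t"
      unfolding carrier_free_skew_field by auto
    have rt: "(RMul r t, RConst 1) \<in> rexp_rel X"
      using P t nondegenerate_RMul[OF r t(1)]
      by (simp add: one_free_skew_field mult_rexp_class[OF r t(1)] nondegenerate_RConst
          flip: rexp_class_eq_iff)
    have "rvars t \<subseteq> X" using t unfolding nondegenerate_def by auto
    then have "rexp_class X t = rexp_class X (RInv r)"
      using t(1) nd by (intro rexp_class_eqI) (auto simp: bind_eq_Some_conv dest: inverse[OF _ _ rt])
    then show "P = rexp_class X (RInv r)" using t by simp
  qed
qed

text \<open>This allows \<open>finsum\<close> over classes to be unfolded one summand at a time, as
  the sums over permutations require.\<close>

lemma abelian_monoid_free_skew_field:
  "abelian_monoid (free_skew_field X :: ('k, 'x) rexp set ring)"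
proof (rule abelian_monoidI)
  let ?F = "free_skew_field X :: ('k, 'x) rexp set ring"
  have car: "A \<in> carrier_mat n n" if "r \<in> nondegenerate X" "a \<in> mat_points X n" "mat_eval n a r = Some A"
    for r :: "('k, 'x) rexp" and n a A
    using that mat_eval_carrier unfolding nondegenerate_def by blast
  show "P \<oplus>\<^bsub>?F\<^esub> Q \<in> carrier ?F" if "P \<in> carrier ?F" "Q \<in> carrier ?F" for P Q
    using that by (auto simp: carrier_free_skew_field add_rexp_class nondegenerate_RAdd)
  show "\<zero>\<^bsub>?F\<^esub> \<in> carrier ?F"
    by (simp add: carrier_free_skew_field zero_free_skew_field nondegenerate_RConst)
  show "P \<oplus>\<^bsub>?F\<^esub> Q \<oplus>\<^bsub>?F\<^esub> R = P \<oplus>\<^bsub>?F\<^esub> (Q \<oplus>\<^bsub>?F\<^esub> R)"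
    if PQR: "P \<in> carrier ?F" "Q \<in> carrier ?F" "R \<in> carrier ?F" for P Q R
  proof -
    obtain r s t where *: "r \<in> nondegenerate X" "s \<in> nondegenerate X" "t \<in> nondegenerate X"
      "P = rexp_class X r" "Q = rexp_class X s" "R = rexp_class X t"
      using PQR unfolding carrier_free_skew_field by auto
    have "rexp_class X (RAdd (RAdd r s) t) = rexp_class X (RAdd r (RAdd s t))"
    proof (rule rexp_class_eqI)
      fix n a A B assume a: "a \<in> mat_points X n"
        and A: "mat_eval n a (RAdd (RAdd r s) t) = Some A" "mat_eval n a (RAdd r (RAdd s t)) = Some B"
      then obtain R S T where e: "mat_eval n a r = Some R" "mat_eval n a s = Some S" "mat_eval n a t = Some T"
        by (auto simp: bind_eq_Some_conv)
      show "A = B"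
        using A e assoc_add_mat[OF car[OF *(1) a e(1)] car[OF *(2) a e(2)] car[OF *(3) a e(3)]] by simp
    qed (use * in \<open>auto intro: nondegenerate_RAdd\<close>)
    with * show ?thesis by (simp add: add_rexp_class nondegenerate_RAdd)
  qed
  show "P \<oplus>\<^bsub>?F\<^esub> Q = Q \<oplus>\<^bsub>?F\<^esub> P" if PQ: "P \<in> carrier ?F" "Q \<in> carrier ?F" for P Q
  proof -
    obtain r s where *: "r \<in> nondegenerate X" "s \<in> nondegenerate X"
      "P = rexp_class X r" "Q = rexp_class X s"
      using PQ unfolding carrier_free_skew_field by auto
    have "rexp_class X (RAdd r s) = rexp_class X (RAdd s r)"
    proof (rule rexp_class_eqI)
      fix n a A B assume a: "a \<in> mat_points X n"
        and A: "mat_eval n a (RAdd r s) = Some A" "mat_eval n a (RAdd s r) = Some B"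
      then obtain R S where e: "mat_eval n a r = Some R" "mat_eval n a s = Some S"
        by (auto simp: bind_eq_Some_conv)
      show "A = B" using A e comm_add_mat[OF car[OF *(1) a e(1)] car[OF *(2) a e(2)]] by simp
    qed (use * in \<open>auto intro: nondegenerate_RAdd\<close>)
    with * show ?thesis by (simp add: add_rexp_class)
  qed
  show "\<zero>\<^bsub>?F\<^esub> \<oplus>\<^bsub>?F\<^esub> P = P" if P: "P \<in> carrier ?F" for P
  proof -
    obtain r where r: "r \<in> nondegenerate X" "P = rexp_class X r"
      using P unfolding carrier_free_skew_field by auto
    have "rexp_class X (RAdd (RConst 0) r) = rexp_class X r"
    proof (rule rexp_class_eqI)
      fix n a A B assume a: "a \<in> mat_points X n" and A: "mat_eval n a (RAdd (RConst 0) r) = Some A"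
        and B: "mat_eval n a r = Some B"
      have "0 \<cdot>\<^sub>m 1\<^sub>m n = (0\<^sub>m n n :: 'k mat)" by (intro eq_matI) auto
      then show "A = B" using A B car[OF r(1) a B] by simp
    qed (use r in \<open>auto intro: nondegenerate_RAdd nondegenerate_RConst\<close>)
    with r show ?thesis by (simp add: add_rexp_class zero_free_skew_field nondegenerate_RConst)
  qed
qed

end

section \<open>From formulas to expressions\<close>

text \<open>The gates feeding \<open>v\<close> are read off as one expression by recursion along the
  arcs. In a formula the gates below the two inputs of a gate are disjoint, so leaf counts add up
  without repetition; with shared gates the expression could be exponentially larger.\<close>

lemma formula_expression:
  fixes \<Phi> :: "('k::field, 'x, 'v, 'e) circuit"
  assumes inf: "infinite (UNIV :: 'k set)"
    and formula: "is_formula X \<Phi>"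
    and val: "\<forall>v\<in>verts (graph \<Phi>). gate_value_ok X \<Phi> val v"
    and v: "v \<in> verts (graph \<Phi>)"
  shows "\<exists>r\<in>nondegenerate X. val v = rexp_class X r \<and>
    var_leaves r \<le> card {u \<in> verts (graph \<Phi>). (u, v) \<in> (arcs_ends (graph \<Phi>))\<^sup>*}"
proof -
  let ?G = "graph \<Phi>" and ?F = "free_skew_field X :: ('k, 'x) rexp set ring"
  let ?R = "arcs_ends ?G"
  define below where "below v = {u \<in> verts ?G. (u, v) \<in> ?R\<^sup>*}" for v
  interpret fin_digraph ?G using formula unfolding is_formula_def is_circuit_def by blast
  have acyc: "acyclic ?R" using formula unfolding is_formula_def is_circuit_def by blast
  have wfg: "well_formed_gate X \<Phi> v" if "v \<in> verts ?G" for v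
    using formula that unfolding is_formula_def is_circuit_def by blast
  have fin: "finite (below v)" for v unfolding below_def using finite_verts by simp
  have below_self: "v \<in> verts ?G \<Longrightarrow> v \<in> below v" for v unfolding below_def by simp
  have arcR: "(tail ?G e, head ?G e) \<in> ?R" if "e \<in> arcs ?G" for e
    using that unfolding arcs_ends_conv by auto
  have out1: "e = e'" if "e \<in> arcs ?G" "e' \<in> arcs ?G" "tail ?G e = tail ?G e'" for e e'
  proof -
    have "out_degree ?G (tail ?G e) \<le> 1"
      using formula that(1) unfolding is_formula_def by simp
    moreover have "{e, e'} \<subseteq> out_arcs ?G (tail ?G e)" using that by auto
    ultimately have "card {e, e'} \<le> 1"
      unfolding out_degree_def using card_mono[OF finite_out_arcs] by (meson le_trans)
    then show ?thesis by (cases "e = e'") auto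
  qed
  \<comment> \<open>Every gate has at most one successor, so the gates reachable from a given one
    form a chain. This makes two inputs above a common gate comparable.\<close>
  have single: "single_valued ?R"
    unfolding single_valued_def arcs_ends_conv using out1 by fastforce
  have disj: "below (tail ?G d) \<inter> below (tail ?G e) = {}"
    if de: "d \<in> arcs ?G" "e \<in> arcs ?G" "d \<noteq> e" "head ?G d = head ?G e" for d e
  proof -
    \<comment> \<open>A path from the tail of \<open>d\<close> to the tail of \<open>e\<close> has
      to leave through \<open>d\<close>, hence passes the common head, and then \<open>e\<close>
      closes a cycle.\<close>
    have no_path: False if "d \<in> arcs ?G" "e \<in> arcs ?G" "d \<noteq> e" "head ?G d = head ?G e"
      "(tail ?G d, tail ?G e) \<in> ?R\<^sup>*" for d e
    proof -
      have "tail ?G d \<noteq> tail ?G e" using out1 that by blast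
      with that(5) obtain w where w: "(tail ?G d, w) \<in> ?R" "(w, tail ?G e) \<in> ?R\<^sup>*"
        by (metis converse_rtranclE)
      have "w = head ?G e" using single_valuedD[OF single w(1) arcR[OF that(1)]] that(4) by simp
      with w(2) arcR[OF that(2)] have "(tail ?G e, tail ?G e) \<in> ?R\<^sup>+"
        by (meson rtrancl_into_trancl2)
      with acyc show False unfolding acyclic_def by blast
    qed
    show ?thesis
    proof (rule ccontr)
      assume "\<not> ?thesis"
      then obtain u where "(u, tail ?G d) \<in> ?R\<^sup>*" "(u, tail ?G e) \<in> ?R\<^sup>*"
        unfolding below_def by blast
      from single_valued_confluent[OF single this] show False
        using no_path[of d e] no_path[of e d] de by metis
    qed
  qed
  have sub: "below (tail ?G e) \<subseteq> below v" if "e \<in> in_arcs ?G v" for e v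
    using arcR[of e] that unfolding below_def by (auto intro: rtrancl_into_rtrancl)
  have "wf ?R"
    using finite_acyclic_wf[OF _ acyc] finite_arcs unfolding arcs_ends_conv by blast
  then have "\<exists>r\<in>nondegenerate X. val v = rexp_class X r \<and> var_leaves r \<le> card (below v)"
    using v
  proof (induction v rule: wf_induct_rule)
    case (less v)
    have IH: "\<exists>r\<in>nondegenerate X. val (tail ?G e) = rexp_class X r \<and>
        var_leaves r \<le> card (below (tail ?G e))" if "e \<in> in_arcs ?G v" for e
      using less.IH[of "tail ?G e"] arcR[of e] that tail_in_verts by auto
    have ok: "gate_value_ok X \<Phi> val v" using val less.prems by blast
    \<comment> \<open>Addition and multiplication gates together, with \<open>c\<close> the
      constructor \<open>RAdd\<close> or \<open>RMul\<close>.\<close>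
    have two: ?case if de: "d \<noteq> e" "d \<in> in_arcs ?G v" "e \<in> in_arcs ?G v"
      and nd: "\<And>r s :: ('k, 'x) rexp. r \<in> nondegenerate X \<Longrightarrow> s \<in> nondegenerate X \<Longrightarrow> c r s \<in> nondegenerate X"
      and v: "\<And>r s. r \<in> nondegenerate X \<Longrightarrow> s \<in> nondegenerate X \<Longrightarrow>
         val (tail ?G d) = rexp_class X r \<Longrightarrow> val (tail ?G e) = rexp_class X s \<Longrightarrow> val v = rexp_class X (c r s)"
      and c: "\<And>r s. var_leaves (c r s) = var_leaves r + var_leaves s" for d e c
    proof -
      obtain r s where r: "r \<in> nondegenerate X" "val (tail ?G d) = rexp_class X r"
          "var_leaves r \<le> card (below (tail ?G d))"
        and s: "s \<in> nondegenerate X" "val (tail ?G e) = rexp_class X s"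
          "var_leaves s \<le> card (below (tail ?G e))"
        using IH[OF de(2)] IH[OF de(3)] by blast
      have "var_leaves r + var_leaves s \<le> card (below (tail ?G d)) + card (below (tail ?G e))"
        using r(3) s(3) by linarith
      also have "\<dots> = card (below (tail ?G d) \<union> below (tail ?G e))"
        using card_Un_disjoint[OF fin fin disj] de by simp
      also have "\<dots> \<le> card (below v)"
        using sub[OF de(2)] sub[OF de(3)] by (intro card_mono fin) auto
      finally show ?thesis using nd[OF r(1) s(1)] v[OF r(1) s(1) r(2) s(2)] c by auto
    qed
    show ?case
    proof (cases "gate \<Phi> v")
      case (ConstGate c)
      then show ?thesis using ok
        by (auto simp: gate_value_ok_def Let_def intro!: bexI[OF _ nondegenerate_RConst])
    next
      case (VarGate x)
      then have "x \<in> X" using wfg[OF less.prems] by (simp add: well_formed_gate_def)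
      moreover have "card (below v) > 0"
        using below_self[OF less.prems] fin[of v] by (auto simp: card_gt_0_iff)
      ultimately show ?thesis using ok VarGate
        by (auto simp: gate_value_ok_def Let_def intro!: bexI[OF _ nondegenerate_RVar])
    next
      case InvGate
      then obtain e where e: "in_arcs ?G v = {e}" "val (tail ?G e) \<in> Units ?F"
        "val v = inv\<^bsub>?F\<^esub> val (tail ?G e)"
        using ok by (auto simp: gate_value_ok_def Let_def)
      have e': "e \<in> in_arcs ?G v" using e(1) by blast
      obtain r where r: "r \<in> nondegenerate X" "val (tail ?G e) = rexp_class X r"
          "var_leaves r \<le> card (below (tail ?G e))"
        using IH[OF e'] by blast
      note inv = inv_rexp_class[OF inf r(1) e(2)[unfolded r(2)]]
      have "card (below (tail ?G e)) \<le> card (below v)" by (rule card_mono[OF fin sub[OF e']])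
      then show ?thesis
        using inv e(3) r by (intro bexI[of _ "RInv r"]) auto
    next
      case AddGate
      then obtain d e where de: "d \<noteq> e" "in_arcs ?G v = {d, e}"
        "val v = val (tail ?G d) \<oplus>\<^bsub>?F\<^esub> val (tail ?G e)"
        using ok by (auto simp: gate_value_ok_def Let_def)
      show ?thesis
        by (rule two[of d e RAdd]) (use de in \<open>auto simp: add_rexp_class[OF inf] nondegenerate_RAdd[OF inf]\<close>)
    next
      case MulGate
      then obtain d e where de: "d \<in> left_arcs \<Phi>" "e \<notin> left_arcs \<Phi>" "in_arcs ?G v = {d, e}"
        "val v = val (tail ?G d) \<otimes>\<^bsub>?F\<^esub> val (tail ?G e)"
        using ok by (auto simp: gate_value_ok_def Let_def)
      show ?thesis
        by (rule two[of d e RMul]) (use de in \<open>auto simp: mult_rexp_class[OF inf] nondegenerate_RMul[OF inf]\<close>)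
    qed
  qed
  then show ?thesis unfolding below_def .
qed


section \<open>Evaluating the determinant and the permanent\<close>

text \<open>A class with a representative defined at all points, as for every polynomial. Any other
  representative must then take the values \<open>f n a\<close> wherever it is defined, which is how
  a formula with inverses is compared with the determinant.\<close>

definition evaluates_to ::
  "'x set \<Rightarrow> ('k::field, 'x) rexp set \<Rightarrow> (nat \<Rightarrow> ('x \<Rightarrow> 'k mat) \<Rightarrow> 'k mat) \<Rightarrow> bool" where
  "evaluates_to X P f \<longleftrightarrow> (\<exists>r\<in>nondegenerate X. P = rexp_class X r \<and>
     (\<forall>n>0. \<forall>a\<in>mat_points X n. mat_eval n a r = Some (f n a)))"

lemma evaluates_to_cong:
  assumes "evaluates_to X P f" "\<And>n a. n > 0 \<Longrightarrow> a \<in> mat_points X n \<Longrightarrow> f n a = g n a"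
  shows "evaluates_to X P g"
  using assms unfolding evaluates_to_def by auto

lemma evaluates_to_carrier_mat:
  assumes "evaluates_to X P f" "n > 0" "a \<in> mat_points X n"
  shows "f n a \<in> carrier_mat n n"
proof -
  obtain r where "rvars r \<subseteq> X" "mat_eval n a r = Some (f n a)"
    using assms unfolding evaluates_to_def nondegenerate_def by auto
  then show ?thesis using mat_eval_carrier assms(3) by blast
qed

lemma evaluates_to_carrier:
  "evaluates_to X P f \<Longrightarrow> P \<in> carrier (free_skew_field X)"
  unfolding evaluates_to_def carrier_free_skew_field by auto

lemma evaluates_to_RConst: "evaluates_to X (rexp_class X (RConst c)) (\<lambda>n a. c \<cdot>\<^sub>m 1\<^sub>m n)"
  unfolding evaluates_to_def using nondegenerate_RConst by fastforce

lemma evaluates_to_RVar: "x \<in> X \<Longrightarrow> evaluates_to X (rexp_class X (RVar x)) (\<lambda>n a. a x)"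
  unfolding evaluates_to_def using nondegenerate_RVar by fastforce

context
  fixes X :: "'x set"
  assumes inf: "infinite (UNIV :: 'k::field set)"
begin

lemma evaluates_to_add:
  fixes P Q :: "('k, 'x) rexp set"
  assumes "evaluates_to X P f" "evaluates_to X Q g"
  shows "evaluates_to X (P \<oplus>\<^bsub>free_skew_field X\<^esub> Q) (\<lambda>n a. f n a + g n a)"
proof -
  obtain r s where r: "r \<in> nondegenerate X" "P = rexp_class X r"
      "\<forall>n>0. \<forall>a\<in>mat_points X n. mat_eval n a r = Some (f n a)"
    and s: "s \<in> nondegenerate X" "Q = rexp_class X s"
      "\<forall>n>0. \<forall>a\<in>mat_points X n. mat_eval n a s = Some (g n a)"
    using assms unfolding evaluates_to_def by blast
  show ?thesis
    unfolding evaluates_to_def r(2) s(2) add_rexp_class[OF inf r(1) s(1)]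
    using r(3) s(3) by (intro bexI[OF _ nondegenerate_RAdd[OF inf r(1) s(1)]]) simp
qed

lemma evaluates_to_mult:
  fixes P Q :: "('k, 'x) rexp set"
  assumes "evaluates_to X P f" "evaluates_to X Q g"
  shows "evaluates_to X (P \<otimes>\<^bsub>free_skew_field X\<^esub> Q) (\<lambda>n a. f n a * g n a)"
proof -
  obtain r s where r: "r \<in> nondegenerate X" "P = rexp_class X r"
      "\<forall>n>0. \<forall>a\<in>mat_points X n. mat_eval n a r = Some (f n a)"
    and s: "s \<in> nondegenerate X" "Q = rexp_class X s"
      "\<forall>n>0. \<forall>a\<in>mat_points X n. mat_eval n a s = Some (g n a)"
    using assms unfolding evaluates_to_def by blast
  show ?thesis
    unfolding evaluates_to_def r(2) s(2) mult_rexp_class[OF inf r(1) s(1)]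
    using r(3) s(3) by (intro bexI[OF _ nondegenerate_RMul[OF inf r(1) s(1)]]) simp
qed

lemma evaluates_to_monomial:
  assumes "\<forall>i\<in>set is. x i \<in> X"
  shows "evaluates_to X
    (foldr (\<lambda>i P. rexp_class X (RVar (x i)) \<otimes>\<^bsub>free_skew_field X\<^esub> P) is
      (\<one>\<^bsub>free_skew_field X\<^esub> :: ('k, 'x) rexp set))
    (\<lambda>n a. foldr (\<lambda>i Q. a (x i) * Q) is (1\<^sub>m n))"
  using assms
proof (induction "is")
  case Nil
  have "1 \<cdot>\<^sub>m 1\<^sub>m n = (1\<^sub>m n :: 'k mat)" for n by (intro eq_matI) auto
  then show ?case using evaluates_to_RConst[of X "1 :: 'k"] by (simp add: one_free_skew_field)
next
  case (Cons i "is")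
  then show ?case by (auto intro!: evaluates_to_mult evaluates_to_RVar)
qed

text \<open>Sums are taken entrywise because the matrix type does not fix the size, which here is
  the varying \<open>n\<close>.\<close>

lemma evaluates_to_finsum:
  fixes g :: "'a \<Rightarrow> ('k, 'x) rexp set"
  assumes "finite I" "\<And>i. i \<in> I \<Longrightarrow> evaluates_to X (g i) (f i)"
  shows "evaluates_to X (\<Oplus>\<^bsub>free_skew_field X\<^esub>i\<in>I. g i)
    (\<lambda>n a. mat n n (\<lambda>ij. \<Sum>i\<in>I. f i n a $$ ij))"
  using assms
proof (induction I rule: finite_induct)
  case empty
  interpret abelian_monoid "free_skew_field X :: ('k, 'x) rexp set ring"
    by (rule abelian_monoid_free_skew_field[OF inf])
  have "0 \<cdot>\<^sub>m 1\<^sub>m n = (mat n n (\<lambda>ij. 0) :: 'k mat)" for n by (intro eq_matI) auto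
  then show ?case using evaluates_to_RConst[of X "0 :: 'k"]
    by (simp add: zero_free_skew_field finsum_empty)
next
  case (insert i I)
  interpret abelian_monoid "free_skew_field X :: ('k, 'x) rexp set ring"
    by (rule abelian_monoid_free_skew_field[OF inf])
  have "(\<Oplus>\<^bsub>free_skew_field X\<^esub>i\<in>insert i I. g i)
      = g i \<oplus>\<^bsub>free_skew_field X\<^esub> (\<Oplus>\<^bsub>free_skew_field X\<^esub>i\<in>I. g i)"
    using insert by (intro finsum_insert) (auto intro: evaluates_to_carrier)
  moreover have "evaluates_to X (g i \<oplus>\<^bsub>free_skew_field X\<^esub> (\<Oplus>\<^bsub>free_skew_field X\<^esub>i\<in>I. g i))
     (\<lambda>n a. f i n a + mat n n (\<lambda>ij. \<Sum>i\<in>I. f i n a $$ ij))"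
    using insert by (intro evaluates_to_add) auto
  moreover have "f i n a + mat n n (\<lambda>ij. \<Sum>i\<in>I. f i n a $$ ij) = mat n n (\<lambda>ij. \<Sum>i\<in>insert i I. f i n a $$ ij)"
    if "n > 0" "a \<in> mat_points X n" for n a
    using evaluates_to_carrier_mat[OF _ that, of "g i" "f i"] insert by (intro eq_matI) auto
  ultimately show ?case by (auto elim: evaluates_to_cong)
qed

end

abbreviation mat_monomial :: "(nat \<Rightarrow> 'x) \<Rightarrow> nat list \<Rightarrow> nat \<Rightarrow> ('x \<Rightarrow> 'k::field mat) \<Rightarrow> 'k mat" where
  "mat_monomial x is n a \<equiv> foldr (\<lambda>i Q. a (x i) * Q) is (1\<^sub>m n)"

lemma evaluates_to_perm_monomial:
  assumes "infinite (UNIV :: 'k::field set)" "\<pi> permutes {1..k}"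
  shows "evaluates_to (matrix_vars k) (perm_monomial k \<pi> :: ('k, nat \<times> nat) rexp set)
    (mat_monomial (\<lambda>i. (i, \<pi> i)) [1..<Suc k])"
proof -
  have "\<forall>i\<in>set [1..<Suc k]. (i, \<pi> i) \<in> matrix_vars k"
  proof
    fix i assume "i \<in> set [1..<Suc k]"
    then have "i \<in> {1..k}" by auto
    moreover from this have "\<pi> i \<in> {1..k}" using permutes_in_image[OF assms(2)] by blast
    ultimately show "(i, \<pi> i) \<in> matrix_vars k" unfolding matrix_vars_def by blast
  qed
  from evaluates_to_monomial[OF assms(1) this] show ?thesis
    unfolding perm_monomial_def Let_def .
qed

lemma evaluates_to_nc_perm:
  assumes inf: "infinite (UNIV :: 'k::field set)"
  shows "evaluates_to (matrix_vars k) (nc_perm k :: ('k, nat \<times> nat) rexp set)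
    (\<lambda>n a. mat n n (\<lambda>ij. \<Sum>\<pi> | \<pi> permutes {1..k}.
       mat_monomial (\<lambda>i. (i, \<pi> i)) [1..<Suc k] n a $$ ij))"
  unfolding nc_perm_def Let_def
  by (intro evaluates_to_finsum[OF inf] finite_permutations finite_atLeastAtMost
      evaluates_to_perm_monomial[OF inf]) (simp only: mem_Collect_eq)

lemma evaluates_to_nc_det:
  assumes inf: "infinite (UNIV :: 'k::field set)"
  shows "evaluates_to (matrix_vars k) (nc_det k :: ('k, nat \<times> nat) rexp set)
    (\<lambda>n a. mat n n (\<lambda>ij. \<Sum>\<pi> | \<pi> permutes {1..k}.
       of_int (sign \<pi>) * mat_monomial (\<lambda>i. (i, \<pi> i)) [1..<Suc k] n a $$ ij))"
    (is "evaluates_to ?X _ ?f")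
proof -
  let ?M = "\<lambda>\<pi>. mat_monomial (\<lambda>i. (i, \<pi> i)) [1..<Suc k]"
  have "evaluates_to ?X (nc_det k :: ('k, nat \<times> nat) rexp set)
    (\<lambda>n a. mat n n (\<lambda>ij. \<Sum>\<pi> | \<pi> permutes {1..k}. (of_int (sign \<pi>) \<cdot>\<^sub>m 1\<^sub>m n * ?M \<pi> n a) $$ ij))"
    unfolding nc_det_def Let_def
    by (intro evaluates_to_finsum[OF inf] finite_permutations finite_atLeastAtMost
        evaluates_to_mult[OF inf] evaluates_to_RConst evaluates_to_perm_monomial[OF inf])
      (simp only: mem_Collect_eq)
  then show ?thesis
  proof (rule evaluates_to_cong)
    fix n and a :: "nat \<times> nat \<Rightarrow> 'k mat" assume n: "n > 0" and a: "a \<in> mat_points ?X n"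
    have c: "?M \<pi> n a \<in> carrier_mat n n" if "\<pi> permutes {1..k}" for \<pi>
      using evaluates_to_carrier_mat[OF evaluates_to_perm_monomial[OF inf that] n a] .
    have "(of_int (sign \<pi>) \<cdot>\<^sub>m 1\<^sub>m n * ?M \<pi> n a) $$ (i, j) = of_int (sign \<pi>) * ?M \<pi> n a $$ (i, j)"
      if "\<pi> permutes {1..k}" "i < n" "j < n" for \<pi> i j
      using mult_smult_assoc_mat[OF one_carrier_mat c[OF that(1)]] c[OF that(1)] that by simp
    then show "mat n n (\<lambda>ij. \<Sum>\<pi> | \<pi> permutes {1..k}. (of_int (sign \<pi>) \<cdot>\<^sub>m 1\<^sub>m n * ?M \<pi> n a) $$ ij) = ?f n a"
      by (intro eq_matI) (auto intro!: sum.cong)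
  qed
qed

section \<open>Chain-shaped points\<close>

text \<open>
  A block bidiagonal matrix with \<open>l\<close> by \<open>l\<close> blocks of size \<open>m\<close>. Blocks are counted from \<open>lo\<close>, and
  \<open>B t\<close> is the block above the diagonal on the step from block \<open>t - 1\<close> to block \<open>t\<close>.
\<close>

definition chain_point ::
  "nat \<Rightarrow> ('x \<Rightarrow> 'k::field mat) \<Rightarrow> (nat \<Rightarrow> 'x \<Rightarrow> nat \<Rightarrow> nat \<Rightarrow> 'k) \<Rightarrow> nat \<Rightarrow> nat \<Rightarrow> 'x \<Rightarrow> 'k mat" where
  "chain_point m A B lo l x = mat (m * l) (m * l) (\<lambda>(i, j).
     if i div m = j div m then A x $$ (i mod m, j mod m)
     else if j div m = Suc (i div m) then B (lo + j div m) x (i mod m) (j mod m)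
     else 0)"

text \<open>\<open>step_left * step_right\<close> is the one block that may be nonzero across a cut:
  \<open>C\<close> in the last block row on the left and the first block column on the right. It
  factors through dimension \<open>m\<close>, and \<open>C\<close> enters the left factor
  alone.\<close>

definition step_left :: "nat \<Rightarrow> (nat \<Rightarrow> nat \<Rightarrow> 'k::field) \<Rightarrow> nat \<Rightarrow> 'k mat" where
  "step_left m C l = mat (m * l) m (\<lambda>(i, b). if Suc (i div m) = l then C (i mod m) b else 0)"

definition step_right :: "nat \<Rightarrow> nat \<Rightarrow> 'k::field mat" where
  "step_right m l = mat m (m * l) (\<lambda>(b, j). if j = b then 1 else 0)"

lemma index_chain_point:
  assumes "i < m * l" "j < m * l"
  shows "chain_point m A B lo l x $$ (i, j) =
    (if i div m = j div m then A x $$ (i mod m, j mod m)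
     else if j div m = Suc (i div m) then B (lo + j div m) x (i mod m) (j mod m)
     else 0)"
  using assms by (simp add: chain_point_def)

lemma chain_point_in_mat_points: "chain_point m A B lo l \<in> mat_points X (m * l)"
  unfolding mat_points_def chain_point_def by auto

text \<open>The bounds are strict because a segment contains neither the step into its first block
  nor the step out of its last one.\<close>

lemma chain_point_cong:
  assumes "m > 0" "\<And>t. lo < t \<Longrightarrow> t < lo + l \<Longrightarrow> B t = B' t"
  shows "chain_point m A B lo l = chain_point m A B' lo l"
proof
  fix x
  show "chain_point m A B lo l x = chain_point m A B' lo l x"
    unfolding chain_point_def
  proof (rule cong_mat[OF refl refl], goal_cases)
    case (1 i j)
    then have "j div m < l" using assms(1) by (simp add: div_less_iff_less_mult mult.commute)
    then show ?case using assms(2)[of "lo + j div m"] by auto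
  qed
qed

lemma chain_point_split:
  assumes m: "m > 0" and l: "l > 0"
  shows "chain_point m A B lo (l + l') x = four_block_mat
    (chain_point m A B lo l x) (step_left m (B (lo + l) x) l * step_right m l')
    (0\<^sub>m (m * l') (m * l)) (chain_point m A B (lo + l) l' x)" (is "?L = four_block_mat ?P ?Y ?Z ?W")
proof (rule eq_matI)
  have Y: "?Y $$ (i, j) = (if Suc (i div m) = l \<and> j < m then B (lo + l) x (i mod m) j else 0)"
    if "i < m * l" "j < m * l'" for i j
  proof -
    have "?Y $$ (i, j) = (\<Sum>b<m. (if Suc (i div m) = l then B (lo + l) x (i mod m) b else 0) * (if j = b then 1 else 0))"
      using that by (simp add: step_left_def step_right_def scalar_prod_def atLeast0LessThan)
    also have "\<dots> = (\<Sum>b<m. if j = b then (if Suc (i div m) = l then B (lo + l) x (i mod m) b else 0) else 0)"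
      by (intro sum.cong) auto
    finally show ?thesis by (auto simp: sum.delta)
  qed
  have shift: "j div m = l + (j - m * l) div m" "j mod m = (j - m * l) mod m" if j: "\<not> j < m * l" for j
  proof -
    obtain j' where j': "j = m * l + j'" using le_Suc_ex[of "m * l" j] j unfolding not_less by blast
    show "j div m = l + (j - m * l) div m" "j mod m = (j - m * l) mod m"
      using m unfolding j' by auto
  qed
  have less: "i div m < l" if "i < m * l" for i
    using that m by (simp add: div_less_iff_less_mult mult.commute)
  fix i j assume ij: "i < dim_row (four_block_mat ?P ?Y ?Z ?W)" "j < dim_col (four_block_mat ?P ?Y ?Z ?W)"
  then have ij': "i < m * (l + l')" "j < m * (l + l')"
    by (auto simp: chain_point_def distrib_left)
  have dims: "dim_row ?P = m * l" "dim_col ?P = m * l" "dim_row ?W = m * l'" "dim_col ?W = m * l'"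
    by (auto simp: chain_point_def)
  have F: "four_block_mat ?P ?Y ?Z ?W $$ (i, j) =
     (if i < m * l then if j < m * l then ?P $$ (i, j) else ?Y $$ (i, j - m * l)
      else if j < m * l then ?Z $$ (i - m * l, j) else ?W $$ (i - m * l, j - m * l))"
    using ij by (subst index_mat_four_block(1)) (simp_all only: index_mat_four_block(2,3) dims)
  note L = index_chain_point[OF ij', of A B lo x]
  show "?L $$ (i, j) = four_block_mat ?P ?Y ?Z ?W $$ (i, j)"
  proof (cases "i < m * l")
    case i: True
    show ?thesis
    proof (cases "j < m * l")
      case True
      show ?thesis unfolding F L using i True by (simp add: index_chain_point)
    next
      case False
      then have j': "j - m * l < m * l'" using ij' by (simp add: distrib_left)
      have small: "(j - m * l) div m = 0 \<longleftrightarrow> j - m * l < m" using m by (simp add: div_eq_0_iff)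
      show ?thesis
        unfolding F L shift[OF False] using i False Y[OF i j'] less[OF i] small by auto
    qed
  next
    case i: False
    then have i': "i - m * l < m * l'" using ij' by (simp add: distrib_left)
    show ?thesis
    proof (cases "j < m * l")
      case True
      show ?thesis unfolding F L shift(1)[OF i] using i i' True less[OF True] by simp
    next
      case False
      then have j': "j - m * l < m * l'" using ij' by (simp add: distrib_left)
      show ?thesis unfolding F L shift[OF i] shift[OF False] using i False
        by (simp add: index_chain_point[OF i' j'] add.assoc)
    qed
  qed
qed (auto simp: chain_point_def distrib_left)

text \<open>Blocks are split off the front one at a time; each diagonal block is \<open>A\<close>,
  so \<open>r\<close> stays defined whatever the superdiagonal blocks are. \<open>lo\<close> varies
  because the remaining segment starts one block later.\<close>

lemma mat_eval_chain_point:
  assumes m: "m > 0" and A: "A \<in> mat_points X m" and r: "rvars r \<subseteq> X" and V: "mat_eval m A r = Some V"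
  shows "\<exists>W. mat_eval (m * Suc l) (chain_point m A B lo (Suc l)) r = Some W"
proof (induction l arbitrary: lo)
  have one: "mat_eval (m * 1) (chain_point m A B lo 1) r = Some V" for lo
  proof -
    have "\<forall>x\<in>X. chain_point m A B lo 1 x = A x"
      using A m unfolding chain_point_def mat_points_def by (auto intro!: eq_matI)
    then show ?thesis using V mat_eval_cong[OF r] by (metis mult.right_neutral)
  qed
  {
    case 0
    show ?case using one by simp
  next
    case (Suc l)
    obtain W where W: "mat_eval (m * Suc l) (chain_point m A B (lo + 1) (Suc l)) r = Some W"
      using Suc by blast
    have "\<exists>C. mat_eval (m * 1 + m * Suc l) (\<lambda>x. four_block_mat (chain_point m A B lo 1 x)
       (step_left m (B (lo + 1) x) 1 * step_right m (Suc l)) (0\<^sub>m (m * Suc l) (m * 1))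
       (chain_point m A B (lo + 1) (Suc l) x)) r = Some C"
      using mat_eval_block_triangular[of "{()}" "\<lambda>_. chain_point m A B lo 1" X "m * 1" "{()}"
          "\<lambda>_. chain_point m A B (lo + 1) (Suc l)" "m * Suc l" "\<lambda>_ x. step_left m (B (lo + 1) x) 1" m
          "\<lambda>_ _. step_right m (Suc l)" r "\<lambda>_. V" "\<lambda>_. W"] one[of lo] W r
        chain_point_in_mat_points[of m A B lo 1 X] chain_point_in_mat_points[of m A B "lo + 1" "Suc l" X]
      unfolding step_left_def step_right_def by fastforce
    moreover have "(\<lambda>x. four_block_mat (chain_point m A B lo 1 x)
       (step_left m (B (lo + 1) x) 1 * step_right m (Suc l)) (0\<^sub>m (m * Suc l) (m * 1))
       (chain_point m A B (lo + 1) (Suc l) x)) = chain_point m A B lo (Suc (Suc l))"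
      using chain_point_split[OF m, of 1 A B lo "Suc l"] by (simp add: fun_eq_iff)
    ultimately show ?case by simp
  }
qed

text \<open>
  With matrix units as the blocks \<open>B t\<close>, the last block column of a product of consecutive factors
  records whether \<open>\<pi>\<close> follows the word \<open>w\<close> and the matrix units compose.
\<close>

lemma mat_monomial_chain_point:
  fixes A :: "nat \<times> nat \<Rightarrow> 'k::field mat"
  assumes m: "m > 0" and st: "\<And>t. start t < m" and st_last: "start (Suc k) = 0"
    and B: "\<And>t x a b. B t x a b = of_bool (x = (t, w t) \<and> a = start t \<and> b = endt t)"
    and i: "i \<le> k"
  defines "N \<equiv> m * Suc k" and "T \<equiv> chain_point m A B 0 (Suc k)"
  shows "mat_monomial (\<lambda>i. (i, \<pi> i)) [Suc i..<Suc k] N T \<in> carrier_mat N N \<and>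
    (\<forall>r<N. r div m \<le> i \<longrightarrow> mat_monomial (\<lambda>i. (i, \<pi> i)) [Suc i..<Suc k] N T $$ (r, m * k) =
      of_bool (r = m * i + start (Suc i) \<and> (\<forall>t\<in>{Suc i..k}. \<pi> t = w t \<and> endt t = start (Suc t))))"
  using i
proof (induction i rule: inc_induct)
  \<comment> \<open>The empty product is the identity matrix, and \<open>start (Suc k) = 0\<close>
    puts the 1 into row \<open>m * k\<close>.\<close>
  case base
  show ?case using m st_last by (auto simp: N_def)
next
  \<comment> \<open>The remaining \<open>k - i\<close> factors move at most one block up each. From
    a block at most \<open>i\<close>, the last block is hence reached only from block
    \<open>i\<close>, by superdiagonal steps throughout; from later blocks the diagonal blocks
    \<open>A\<close> would contribute, hence the restriction on rows.\<close>
  case (step i)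
  let ?M = "mat_monomial (\<lambda>i. (i, \<pi> i)) [Suc (Suc i)..<Suc k] N T"
  have M: "?M \<in> carrier_mat N N" using step.IH by blast
  have T: "T x \<in> carrier_mat N N" for x unfolding T_def N_def chain_point_def by simp
  have upt: "[Suc i..<Suc k] = Suc i # [Suc (Suc i)..<Suc k]" using step.hyps by (simp add: upt_conv_Cons)
  let ?C = "\<lambda>i. \<forall>t\<in>{Suc i..k}. \<pi> t = w t \<and> endt t = start (Suc t)"
  let ?x = "(Suc i, \<pi> (Suc i))"
  define j\<^sub>0 where "j\<^sub>0 = m * Suc i + start (Suc (Suc i))"
  have j0: "j\<^sub>0 div m = Suc i" "j\<^sub>0 mod m = start (Suc (Suc i))"
    unfolding j\<^sub>0_def using m st[of "Suc (Suc i)"] by (simp_all del: mult_Suc_right)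
  have "j\<^sub>0 < m * Suc (Suc i)" unfolding j\<^sub>0_def using st[of "Suc (Suc i)"] by simp
  also have "\<dots> \<le> N" unfolding N_def using step.hyps by (intro mult_le_mono2) simp
  finally have j0N: "j\<^sub>0 < N" .
  have colN: "m * k < N" unfolding N_def using m by simp
  have C: "?C i \<longleftrightarrow> \<pi> (Suc i) = w (Suc i) \<and> endt (Suc i) = start (Suc (Suc i)) \<and> ?C (Suc i)"
  proof -
    have "{Suc i..k} = insert (Suc i) {Suc (Suc i)..k}" using step.hyps by auto
    then show ?thesis by auto
  qed
  have "(T ?x * ?M) $$ (r, m * k) = of_bool (r = m * i + start (Suc i) \<and> ?C i)"
    if r: "r < N" "r div m \<le> i" for r
  proof -
    have "(T ?x * ?M) $$ (r, m * k) = (\<Sum>j<N. T ?x $$ (r, j) * ?M $$ (j, m * k))"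
      using T[of ?x] M r(1) colN by (simp add: scalar_prod_def atLeast0LessThan)
    also have "\<dots> = (\<Sum>j<N. if j = j\<^sub>0 then T ?x $$ (r, j\<^sub>0) * of_bool (?C (Suc i)) else 0)"
    proof (rule sum.cong[OF refl])
      fix j assume j: "j \<in> {..<N}"
      show "T ?x $$ (r, j) * ?M $$ (j, m * k) = (if j = j\<^sub>0 then T ?x $$ (r, j\<^sub>0) * of_bool (?C (Suc i)) else 0)"
      \<comment> \<open>Beyond block \<open>Suc i\<close> the induction hypothesis is silent, but a
        single factor cannot get there from a block at most \<open>i\<close>.\<close>
      proof (cases "j div m \<le> Suc i")
        case True
        then have "?M $$ (j, m * k) = of_bool (j = j\<^sub>0 \<and> ?C (Suc i))"
          using step.IH j unfolding j\<^sub>0_def by blast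
        then show ?thesis by simp
      next
        case False
        then have "T ?x $$ (r, j) = 0" using r j unfolding T_def chain_point_def N_def by auto
        then show ?thesis using False j0(1) by auto
      qed
    qed
    also have "\<dots> = T ?x $$ (r, j\<^sub>0) * of_bool (?C (Suc i))" using j0N by simp
    also have "T ?x $$ (r, j\<^sub>0) = (if r div m = i then B (Suc i) ?x (r mod m) (start (Suc (Suc i))) else 0)"
      using r j0N j0 unfolding T_def chain_point_def N_def by auto
    also have "\<dots> = of_bool (r = m * i + start (Suc i) \<and> \<pi> (Suc i) = w (Suc i) \<and> endt (Suc i) = start (Suc (Suc i)))"
    proof -
      have "r = m * i + start (Suc i) \<longleftrightarrow> r div m = i \<and> r mod m = start (Suc i)"
        using m st[of "Suc i"] by (metis div_mult_mod_eq mult.commute div_mult_self4 mod_mult_self4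
            div_less mod_less add.right_neutral neq0_conv)
      then show ?thesis unfolding B by auto
    qed
    finally show ?thesis unfolding C by (simp add: of_bool_conj)
  qed
  with mult_carrier_mat[OF T M] show ?case unfolding upt foldr.simps comp_def by blast
qed



section \<open>The rank bound\<close>

text \<open>The matrix of all products is diagonal with nonzero diagonal, so it has rank
  \<open>card I\<close>, yet it factors through dimension \<open>n\<close>. In terms of
  determinants: were \<open>n < card I\<close>, padding to square matrices \<open>U\<close> and
  \<open>V\<close> would give \<open>U\<close> a zero column, although \<open>det (U * V)\<close> is
  nonzero.\<close>

lemma card_dual_system_le:
  fixes u v :: "'a \<Rightarrow> 'k::field vec"
  assumes I: "finite I" and u: "\<forall>\<alpha>\<in>I. u \<alpha> \<in> carrier_vec n" and v: "\<forall>\<beta>\<in>I. v \<beta> \<in> carrier_vec n"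
    and dual: "\<forall>\<alpha>\<in>I. \<forall>\<beta>\<in>I. u \<alpha> \<bullet> v \<beta> = 0 \<longleftrightarrow> \<alpha> \<noteq> \<beta>"
  shows "card I \<le> n"
proof (rule ccontr)
  assume "\<not> card I \<le> n"
  then have n: "n < card I" by simp
  let ?N = "card I"
  obtain f where f: "bij_betw f {0..<?N} I" using ex_bij_betw_nat_finite[OF I] by blast
  then have fI: "f i \<in> I" if "i < ?N" for i using that bij_betwE by fastforce
  have f_eq: "f i = f j \<longleftrightarrow> i = j" if "i < ?N" "j < ?N" for i j
    using f that by (auto simp: bij_betw_def inj_on_def)
  define U where "U = mat ?N ?N (\<lambda>(i, l). if l < n then u (f i) $ l else 0)"
  define V where "V = mat ?N ?N (\<lambda>(l, j). if l < n then v (f j) $ l else 0)"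
  have c: "U \<in> carrier_mat ?N ?N" "V \<in> carrier_mat ?N ?N" unfolding U_def V_def by auto
  have UV: "(U * V) $$ (i, j) = u (f i) \<bullet> v (f j)" if "i < ?N" "j < ?N" for i j
  proof -
    have "(U * V) $$ (i, j) = (\<Sum>l<?N. if l < n then u (f i) $ l * v (f j) $ l else 0)"
      using that unfolding U_def V_def
      by (auto simp: scalar_prod_def atLeast0LessThan intro!: sum.cong)
    also have "\<dots> = (\<Sum>l\<in>{..<?N} \<inter> {l. l < n}. u (f i) $ l * v (f j) $ l)"
      by (simp add: sum.inter_restrict)
    also have "{..<?N} \<inter> {l. l < n} = {0..<n}" using n by auto
    finally show ?thesis using bspec[OF v fI[OF that(2)]] by (simp add: scalar_prod_def)
  qed
  have "det (U * V) = prod_list (diag_mat (U * V))"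
  proof (rule det_upper_triangular)
    show "U * V \<in> carrier_mat ?N ?N" using c by simp
    show "upper_triangular (U * V)"
    proof (rule upper_triangularI)
      fix i j assume "j < i" "i < dim_row (U * V)"
      then have ij: "j < i" "i < ?N" "j < ?N" using c by auto
      then show "(U * V) $$ (i, j) = 0" using UV dual fI f_eq by simp
    qed
  qed
  also have "\<dots> \<noteq> 0"
    using c UV dual fI by (auto simp: prod_list_zero_iff diag_mat_def)
  finally have "det U \<noteq> 0" using det_mult[OF c] by auto
  moreover have "det U = 0"
  proof -
    have "U *\<^sub>v unit_vec ?N n = 0\<^sub>v ?N"
    proof (rule eq_vecI)
      fix i assume "i < dim_vec (0\<^sub>v ?N :: 'k vec)"
      then have "i < ?N" by simp
      then show "(U *\<^sub>v unit_vec ?N n) $ i = 0\<^sub>v ?N $ i"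
        using n unfolding U_def by simp
    qed (simp add: U_def)
    moreover have "unit_vec ?N n \<noteq> (0\<^sub>v ?N :: 'k vec)"
      using n by (metis index_unit_vec(1) index_zero_vec(1) zero_neq_one)
    ultimately show ?thesis
      unfolding det_0_iff_vec_prod_zero_field[OF c(1)] by (intro exI[of _ "unit_vec ?N n"]) simp
  qed
  ultimately show False by blast
qed

section \<open>Nisan's rank argument for the determinant and the permanent\<close>

lemma permutation_onto_subset:
  assumes S: "S \<subseteq> {1..k}" "card S = h"
  obtains \<sigma> where "\<sigma> permutes {1..k}" "\<sigma> ` {1..h} = S" "\<sigma> ` {Suc h..k} = {1..k} - S"
proof -
  have fin: "finite S" using S(1) finite_subset by blast
  have hk: "h \<le> k" using card_mono[OF _ S(1)] S(2) by simp
  obtain f where f: "bij_betw f {1..h} S"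
    using finite_same_card_bij[OF _ fin, of "{1..h}"] S(2) by auto
  obtain g where g: "bij_betw g {Suc h..k} ({1..k} - S)"
    using finite_same_card_bij[of "{Suc h..k}" "{1..k} - S"] S card_Diff_subset[OF fin S(1)] by auto
  define \<sigma> where "\<sigma> i = (if i \<in> {1..h} then f i else if i \<in> {Suc h..k} then g i else i)" for i
  have f': "bij_betw \<sigma> {1..h} S"
    using f by (rule bij_betw_cong[THEN iffD1, rotated]) (simp add: \<sigma>_def)
  have g': "bij_betw \<sigma> {Suc h..k} ({1..k} - S)"
    using g by (rule bij_betw_cong[THEN iffD1, rotated]) (simp add: \<sigma>_def)
  have "bij_betw \<sigma> ({1..h} \<union> {Suc h..k}) (S \<union> ({1..k} - S))"
    by (rule bij_betw_combine[OF f' g']) blast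
  moreover have "{1..h} \<union> {Suc h..k} = {1..k}" using hk by auto
  moreover have "S \<union> ({1..k} - S) = {1..k}" using S(1) by blast
  ultimately have "bij_betw \<sigma> {1..k} {1..k}" by simp
  then have "\<sigma> permutes {1..k}"
    by (rule bij_imp_permutes) (use hk in \<open>auto simp: \<sigma>_def\<close>)
  with f' g' show ?thesis using that unfolding bij_betw_def by blast
qed

text \<open>The coefficients \<open>c\<close> stand for the signs or for the constant 1; all that
  matters is that they are nonzero. Letting the superdiagonal blocks range over matrix units yields
  vectors \<open>row (P \<alpha>) 0\<close> and \<open>col (Q \<beta>) (m * (k - h))\<close> of
  length \<open>var_leaves r * m\<close> that form a dual system.\<close>

lemma binomial_le_var_leaves:
  fixes r :: "('k::field, nat \<times> nat) rexp" and c :: "(nat \<Rightarrow> nat) \<Rightarrow> 'k"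
  assumes r: "r \<in> nondegenerate (matrix_vars k)"
    and eval: "\<And>n a V. n > 0 \<Longrightarrow> a \<in> mat_points (matrix_vars k) n \<Longrightarrow> mat_eval n a r = Some V \<Longrightarrow>
      V = mat n n (\<lambda>ij. \<Sum>\<pi> | \<pi> permutes {1..k}. c \<pi> * mat_monomial (\<lambda>i. (i, \<pi> i)) [1..<Suc k] n a $$ ij)"
    and c: "\<And>\<pi>. c \<pi> \<noteq> 0"
    and h: "0 < h" "h < k"
  shows "k choose h \<le> var_leaves r"
proof -
  let ?X = "matrix_vars k"
  obtain m A V\<^sub>0 where rX: "rvars r \<subseteq> ?X" and m: "m > 0" and A: "A \<in> mat_points ?X m"
    and V0: "mat_eval m A r = Some V\<^sub>0"
    by (rule nondegenerateE[OF r])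
  define \<S> where "\<S> = {S. S \<subseteq> {1..k} \<and> card S = h}"
  have "\<exists>\<sigma>. \<forall>S\<in>\<S>. \<sigma> S permutes {1..k} \<and> \<sigma> S ` {1..h} = S \<and> \<sigma> S ` {Suc h..k} = {1..k} - S"
  proof (rule bchoice, rule ballI)
    fix S assume "S \<in> \<S>"
    then have "S \<subseteq> {1..k}" "card S = h" unfolding \<S>_def by auto
    from permutation_onto_subset[OF this]
    show "\<exists>\<sigma>. \<sigma> permutes {1..k} \<and> \<sigma> ` {1..h} = S \<and> \<sigma> ` {Suc h..k} = {1..k} - S" by metis
  qed
  then obtain \<sigma> where "\<forall>S\<in>\<S>. \<sigma> S permutes {1..k} \<and> \<sigma> S ` {1..h} = S \<and> \<sigma> S ` {Suc h..k} = {1..k} - S"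
    by (rule exE)
  note \<sigma>_all = bspec[OF this]
  note \<sigma> = conjunct1[OF \<sigma>_all] conjunct1[OF conjunct2[OF \<sigma>_all]] conjunct2[OF conjunct2[OF \<sigma>_all]]
  \<comment> \<open>An index is a set of columns used by the first \<open>h\<close> factors together
    with the basis vector, one of \<open>m\<close>, that is passed on at the cut.\<close>
  define I where "I = \<S> \<times> {..<m}"
  have \<S>: "finite \<S>" "card \<S> = k choose h" unfolding \<S>_def using n_subsets[of "{1..k}" h] by auto
  have I: "finite I" "card I = (k choose h) * m" unfolding I_def using \<S> by auto
  define w where "w = (\<lambda>(\<alpha> :: nat set \<times> nat) (\<beta> :: nat set \<times> nat) t. if t \<le> h then \<sigma> (fst \<alpha>) t else \<sigma> (fst \<beta>) t)"
  \<comment> \<open>The blocks are matrix units with row \<open>start\<close> and column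
    \<open>endt\<close>. All meet at index 0 except at the cut, where step \<open>h\<close> ends in
    \<open>snd \<alpha>\<close> and step \<open>Suc h\<close> starts in \<open>snd \<beta>\<close>,
    so the product survives only if these agree.\<close>
  define start where "start = (\<lambda>(\<beta> :: nat set \<times> nat) t. if t = Suc h then snd \<beta> else 0)"
  define endt where "endt = (\<lambda>(\<alpha> :: nat set \<times> nat) t. if t = h then snd \<alpha> else 0)"
  define B\<^sub>l where "B\<^sub>l \<alpha> t x a b = (of_bool (x = (t, \<sigma> (fst \<alpha>) t) \<and> a = 0 \<and> b = endt \<alpha> t) :: 'k)" for \<alpha> t x and a b :: nat
  define B\<^sub>r where "B\<^sub>r \<beta> t x a b = (of_bool (x = (t, \<sigma> (fst \<beta>) t) \<and> a = start \<beta> t \<and> b = 0) :: 'k)" for \<beta> t x and a b :: nat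
  define B where "B \<alpha> \<beta> t x a b = (of_bool (x = (t, w \<alpha> \<beta> t) \<and> a = start \<beta> t \<and> b = endt \<alpha> t) :: 'k)" for \<alpha> \<beta> t x and a b :: nat
  \<comment> \<open>Step \<open>h\<close> itself crosses the cut and is counted to the left. Left
    blocks must not see \<beta>, nor right blocks \<alpha>, as the factors \<open>P\<close> and
    \<open>Q\<close> have to depend on one index each.\<close>
  have Bl: "B \<alpha> \<beta> t = B\<^sub>l \<alpha> t" if "t \<le> h" for \<alpha> \<beta> t
    using that by (auto simp: fun_eq_iff B_def B\<^sub>l_def w_def start_def)
  have Br: "B \<alpha> \<beta> t = B\<^sub>r \<beta> t" if "h < t" for \<alpha> \<beta> t
    using that by (auto simp: fun_eq_iff B_def B\<^sub>r_def w_def endt_def)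
  \<comment> \<open>\<open>k\<close> steps join \<open>Suc k\<close> blocks; the \<open>h\<close>
    blocks numbered below \<open>h\<close> lie to the left of the cut.\<close>
  define p q where "p = m * h" and "q = m * (Suc k - h)"
  have pq: "p + q = m * Suc k" unfolding p_def q_def using h by (simp flip: distrib_left)
  let ?L = "\<lambda>\<alpha>. chain_point m A (B\<^sub>l \<alpha>) 0 h" and ?R = "\<lambda>\<beta>. chain_point m A (B\<^sub>r \<beta>) h (Suc k - h)"
  let ?U = "\<lambda>\<alpha> x. step_left m (B\<^sub>l \<alpha> h x) h" and ?W = "step_right m (Suc k - h)"
  let ?T = "\<lambda>\<alpha> \<beta>. chain_point m A (B \<alpha> \<beta>) 0 (Suc k)"
  have T: "?T \<alpha> \<beta> = (\<lambda>x. four_block_mat (?L \<alpha> x) (?U \<alpha> x * ?W) (0\<^sub>m q p) (?R \<beta> x))" for \<alpha> \<beta>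
  proof
    fix x
    have "?T \<alpha> \<beta> x = four_block_mat (chain_point m A (B \<alpha> \<beta>) 0 h x)
      (step_left m (B \<alpha> \<beta> h x) h * ?W) (0\<^sub>m q p) (chain_point m A (B \<alpha> \<beta>) h (Suc k - h) x)"
      using chain_point_split[OF m h(1), of A "B \<alpha> \<beta>" 0 "Suc k - h" x] h unfolding p_def q_def by simp
    moreover have "chain_point m A (B \<alpha> \<beta>) 0 h = ?L \<alpha>"
      by (rule chain_point_cong[OF m]) (simp add: Bl)
    moreover have "chain_point m A (B \<alpha> \<beta>) h (Suc k - h) = ?R \<beta>"
      by (rule chain_point_cong[OF m]) (simp add: Br)
    ultimately show "?T \<alpha> \<beta> x = four_block_mat (?L \<alpha> x) (?U \<alpha> x * ?W) (0\<^sub>m q p) (?R \<beta> x)"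
      by (simp add: Bl)
  qed
  have "\<exists>V. mat_eval p (?L \<alpha>) r = Some V" for \<alpha>
    using mat_eval_chain_point[OF m A rX V0, where l = "h - 1"] h unfolding p_def by simp
  then obtain VL where VL: "\<And>\<alpha>. mat_eval p (?L \<alpha>) r = Some (VL \<alpha>)" by metis
  have "\<exists>V. mat_eval q (?R \<beta>) r = Some V" for \<beta>
    using mat_eval_chain_point[OF m A rX V0, where l = "k - h"] h unfolding q_def by (simp add: Suc_diff_le)
  then obtain VR where VR: "\<And>\<beta>. mat_eval q (?R \<beta>) r = Some (VR \<beta>)" by metis
  have "\<exists>P Q. (\<forall>\<alpha>\<in>I. P \<alpha> \<in> carrier_mat p (var_leaves r * m)) \<and>
    (\<forall>\<beta>\<in>I. Q \<beta> \<in> carrier_mat (var_leaves r * m) q) \<and>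
    (\<forall>\<alpha>\<in>I. \<forall>\<beta>\<in>I. mat_eval (p + q)
       (\<lambda>x. four_block_mat (?L \<alpha> x) (?U \<alpha> x * ?W) (0\<^sub>m q p) (?R \<beta> x)) r
       = Some (four_block_mat (VL \<alpha>) (P \<alpha> * Q \<beta>) (0\<^sub>m q p) (VR \<beta>)))"
    by (rule mat_eval_block_triangular[OF _ _ _ _ rX])
      (simp_all add: VL VR, simp_all add: p_def q_def chain_point_in_mat_points step_left_def step_right_def)
  then obtain P Q where PQ_all: "(\<forall>\<alpha>\<in>I. P \<alpha> \<in> carrier_mat p (var_leaves r * m)) \<and>
    (\<forall>\<beta>\<in>I. Q \<beta> \<in> carrier_mat (var_leaves r * m) q) \<and>
    (\<forall>\<alpha>\<in>I. \<forall>\<beta>\<in>I. mat_eval (p + q)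
       (\<lambda>x. four_block_mat (?L \<alpha> x) (?U \<alpha> x * ?W) (0\<^sub>m q p) (?R \<beta> x)) r
       = Some (four_block_mat (VL \<alpha>) (P \<alpha> * Q \<beta>) (0\<^sub>m q p) (VR \<beta>)))"
    by (elim exE)
  note P = bspec[OF conjunct1[OF PQ_all]] and Q = bspec[OF conjunct1[OF conjunct2[OF PQ_all]]]
    and PQ = bspec[OF bspec[OF conjunct2[OF conjunct2[OF PQ_all]]], folded T, unfolded pq]
  have "m * (k - h) < m * (Suc k - h)" using m h by auto
  then have p0: "0 < p" and col: "m * (k - h) < q" "m * k = p + m * (k - h)"
    unfolding p_def q_def using m h by (auto simp flip: distrib_left)
  \<comment> \<open>The entry at row 0 and column \<open>m * k\<close>, the first column of the last
    block, lies in the corner \<open>P * Q\<close>, where that column is number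
    \<open>m * (k - h)\<close>. It is computed once through the factorization and once through the
    monomials.\<close>
  have entry: "row (P \<alpha>) 0 \<bullet> col (Q \<beta>) (m * (k - h)) =
     (\<Sum>\<pi> | \<pi> permutes {1..k}. c \<pi> * of_bool ((\<forall>t\<in>{1..k}. \<pi> t = w \<alpha> \<beta> t) \<and> snd \<alpha> = snd \<beta>))"
    if \<alpha>: "\<alpha> \<in> I" and \<beta>: "\<beta> \<in> I" for \<alpha> \<beta>
  proof -
    have VLc: "VL \<alpha> \<in> carrier_mat p p" and VRc: "VR \<beta> \<in> carrier_mat q q"
      using mat_eval_carrier[OF rX _ VL[of \<alpha>]] mat_eval_carrier[OF rX _ VR[of \<beta>]]
      unfolding p_def q_def by (simp_all add: chain_point_in_mat_points)
    have "row (P \<alpha>) 0 \<bullet> col (Q \<beta>) (m * (k - h)) = four_block_mat (VL \<alpha>) (P \<alpha> * Q \<beta>) (0\<^sub>m q p) (VR \<beta>) $$ (0, m * k)"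
      using VLc VRc P[OF \<alpha>] Q[OF \<beta>] p0 col by simp
    also have "\<dots> = (\<Sum>\<pi> | \<pi> permutes {1..k}. c \<pi> *
       mat_monomial (\<lambda>i. (i, \<pi> i)) [1..<Suc k] (m * Suc k) (?T \<alpha> \<beta>) $$ (0, m * k))"
    proof (subst eval[OF _ chain_point_in_mat_points PQ[OF \<alpha> \<beta>]])
      show "0 < m * Suc k" using m by simp
      show "mat (m * Suc k) (m * Suc k) (\<lambda>ij. \<Sum>\<pi> | \<pi> permutes {1..k}. c \<pi> *
         mat_monomial (\<lambda>i. (i, \<pi> i)) [1..<Suc k] (m * Suc k) (?T \<alpha> \<beta>) $$ ij) $$ (0, m * k)
        = (\<Sum>\<pi> | \<pi> permutes {1..k}. c \<pi> *
         mat_monomial (\<lambda>i. (i, \<pi> i)) [1..<Suc k] (m * Suc k) (?T \<alpha> \<beta>) $$ (0, m * k))"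
        using m by (subst index_mat(1)) (simp_all only: mult_less_mono2 lessI mult_Suc_right zero_less_Suc trans_less_add1 nat_0_less_mult_iff)
    qed
    also have "\<dots> = (\<Sum>\<pi> | \<pi> permutes {1..k}. c \<pi> * of_bool ((\<forall>t\<in>{1..k}. \<pi> t = w \<alpha> \<beta> t) \<and> snd \<alpha> = snd \<beta>))"
    proof (intro sum.cong refl arg_cong2[where f = "(*)"])
      fix \<pi>
      have "start \<beta> t < m" for t using \<beta> m unfolding start_def I_def by auto
      then have "mat_monomial (\<lambda>i. (i, \<pi> i)) [Suc 0..<Suc k] (m * Suc k) (?T \<alpha> \<beta>) $$ (0, m * k)
        = of_bool (0 = m * 0 + start \<beta> (Suc 0) \<and> (\<forall>t\<in>{Suc 0..k}. \<pi> t = w \<alpha> \<beta> t \<and> endt \<alpha> t = start \<beta> (Suc t)))"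
        using mat_monomial_chain_point[OF m, of "start \<beta>" k "B \<alpha> \<beta>" "w \<alpha> \<beta>" "endt \<alpha>" 0 A \<pi>] m h
        unfolding start_def by (simp add: B_def start_def)
      also have "\<dots> = of_bool ((\<forall>t\<in>{1..k}. \<pi> t = w \<alpha> \<beta> t) \<and> snd \<alpha> = snd \<beta>)"
        using h unfolding start_def endt_def by (intro arg_cong[where f = of_bool]) auto
      finally show "mat_monomial (\<lambda>i. (i, \<pi> i)) [1..<Suc k] (m * Suc k) (?T \<alpha> \<beta>) $$ (0, m * k)
        = of_bool ((\<forall>t\<in>{1..k}. \<pi> t = w \<alpha> \<beta> t) \<and> snd \<alpha> = snd \<beta>)" by simp
    qed
    finally show ?thesis .
  qed
  have "card I \<le> var_leaves r * m"
  proof (rule card_dual_system_le[OF I(1), of "\<lambda>\<alpha>. row (P \<alpha>) 0" _ "\<lambda>\<beta>. col (Q \<beta>) (m * (k - h))"])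
    show "\<forall>\<alpha>\<in>I. row (P \<alpha>) 0 \<in> carrier_vec (var_leaves r * m)" using P p0 by auto
    show "\<forall>\<beta>\<in>I. col (Q \<beta>) (m * (k - h)) \<in> carrier_vec (var_leaves r * m)" using Q col by auto
    show "\<forall>\<alpha>\<in>I. \<forall>\<beta>\<in>I. row (P \<alpha>) 0 \<bullet> col (Q \<beta>) (m * (k - h)) = 0 \<longleftrightarrow> \<alpha> \<noteq> \<beta>"
    proof (intro ballI)
      fix \<alpha> \<beta> assume \<alpha>: "\<alpha> \<in> I" and \<beta>: "\<beta> \<in> I"
      then have S: "fst \<alpha> \<in> \<S>" "fst \<beta> \<in> \<S>" unfolding I_def by auto
      show "row (P \<alpha>) 0 \<bullet> col (Q \<beta>) (m * (k - h)) = 0 \<longleftrightarrow> \<alpha> \<noteq> \<beta>"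
      proof (cases "\<alpha> = \<beta>")
        case True
        have w: "(\<forall>t\<in>{1..k}. \<pi> t = w \<alpha> \<alpha> t) \<longleftrightarrow> \<pi> = \<sigma> (fst \<alpha>)" if "\<pi> permutes {1..k}" for \<pi>
          using that \<sigma>(1)[OF S(1)] unfolding w_def permutes_def fun_eq_iff by metis
        have "row (P \<alpha>) 0 \<bullet> col (Q \<beta>) (m * (k - h)) =
          (\<Sum>\<pi> | \<pi> permutes {1..k}. if \<pi> = \<sigma> (fst \<alpha>) then c \<pi> else 0)"
          unfolding entry[OF \<alpha> \<beta>] unfolding True[symmetric]
        proof (intro sum.cong refl)
          fix \<pi> assume "\<pi> \<in> {\<pi>. \<pi> permutes {1..k}}"
          then have "(\<forall>t\<in>{1..k}. \<pi> t = w \<alpha> \<alpha> t) \<longleftrightarrow> \<pi> = \<sigma> (fst \<alpha>)" using w by blast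
          then show "c \<pi> * of_bool ((\<forall>t\<in>{1..k}. \<pi> t = w \<alpha> \<alpha> t) \<and> snd \<alpha> = snd \<alpha>)
            = (if \<pi> = \<sigma> (fst \<alpha>) then c \<pi> else 0)" by simp
        qed
        also have "\<dots> = c (\<sigma> (fst \<alpha>))"
          using \<sigma>(1)[OF S(1)] by (subst sum.delta) (auto simp: finite_permutations)
        finally show ?thesis using True c by simp
      next
        case False
        \<comment> \<open>Such a permutation would send \<open>{1..h}\<close> onto
          \<open>fst \<alpha>\<close> and the rest onto the complement of
          \<open>fst \<beta>\<close>. By injectivity \<open>fst \<alpha>\<close> is contained in
          \<open>fst \<beta>\<close>, and equal cardinalities make them equal.\<close>
        have "\<not> ((\<forall>t\<in>{1..k}. \<pi> t = w \<alpha> \<beta> t) \<and> snd \<alpha> = snd \<beta>)" if \<pi>: "\<pi> permutes {1..k}" for \<pi>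
        proof
          assume *: "(\<forall>t\<in>{1..k}. \<pi> t = w \<alpha> \<beta> t) \<and> snd \<alpha> = snd \<beta>"
          then have "fst \<alpha> \<noteq> fst \<beta>" using False by (simp add: prod_eq_iff)
          have "\<pi> ` {1..h} = \<sigma> (fst \<alpha>) ` {1..h}" "\<pi> ` {Suc h..k} = \<sigma> (fst \<beta>) ` {Suc h..k}"
            using * h by (auto simp: w_def intro!: image_cong)
          then have "\<pi> ` {1..h} = fst \<alpha>" "\<pi> ` {Suc h..k} = {1..k} - fst \<beta>" using \<sigma> S by auto
          moreover have "\<pi> ` {1..h} \<inter> \<pi> ` {Suc h..k} = {}"
            using permutes_inj[OF \<pi>] by (auto simp: inj_eq)
          ultimately have "fst \<alpha> \<subseteq> fst \<beta>" using S unfolding \<S>_def by blast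
          moreover have "finite (fst \<beta>)" "card (fst \<alpha>) = card (fst \<beta>)"
            using S unfolding \<S>_def by (auto intro: finite_subset)
          ultimately show False using card_subset_eq \<open>fst \<alpha> \<noteq> fst \<beta>\<close> by blast
        qed
        then show ?thesis unfolding entry[OF \<alpha> \<beta>] using False by (auto intro!: sum.neutral)
      qed
    qed
  qed
  then show ?thesis using I(2) m by simp
qed

text \<open>The expression read off the formula and the inverse-free one of the determinant or
  permanent represent the same class, so they agree wherever the former is defined.\<close>

lemma nc_det_perm_formula_size:
  fixes \<Phi> :: "('k::field, nat \<times> nat, 'v, 'e) circuit"
  assumes inf: "infinite (UNIV :: 'k set)" and formula: "is_formula (matrix_vars k) \<Phi>"
    and computes: "computes (matrix_vars k) \<Phi> (nc_det k) \<or> computes (matrix_vars k) \<Phi> (nc_perm k)"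
    and h: "0 < h" "h < k"
  shows "k choose h \<le> circuit_size \<Phi>"
proof -
  let ?X = "matrix_vars k"
  obtain f and c :: "(nat \<Rightarrow> nat) \<Rightarrow> 'k" where f: "computes ?X \<Phi> f" and c: "\<And>\<pi>. c \<pi> \<noteq> 0"
    and ev: "evaluates_to ?X f (\<lambda>n a. mat n n (\<lambda>ij. \<Sum>\<pi> | \<pi> permutes {1..k}.
       c \<pi> * mat_monomial (\<lambda>i. (i, \<pi> i)) [1..<Suc k] n a $$ ij))"
    using computes
  proof
    assume "computes ?X \<Phi> (nc_det k)"
    then show ?thesis
      \<comment> \<open>A sign is 1 or -1, nonzero in every characteristic.\<close>
      by (rule that[OF _ _ evaluates_to_nc_det[OF inf]]) (auto simp: sign_def)
  next
    assume "computes ?X \<Phi> (nc_perm k)"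
    then show ?thesis
      by (rule that[of _ "\<lambda>_. 1"]) (use evaluates_to_nc_perm[OF inf, of k] in simp_all)
  qed
  obtain val v where val: "\<forall>v\<in>verts (graph \<Phi>). gate_value_ok ?X \<Phi> val v"
    and v: "v \<in> verts (graph \<Phi>)" "val v = f"
    using f unfolding computes_def by blast
  obtain r where r: "r \<in> nondegenerate ?X" "f = rexp_class ?X r"
    "var_leaves r \<le> card {u \<in> verts (graph \<Phi>). (u, v) \<in> (arcs_ends (graph \<Phi>))\<^sup>*}"
    using formula_expression[OF inf formula val v(1)] v(2) by blast
  obtain s where s: "s \<in> nondegenerate ?X" "f = rexp_class ?X s"
    "\<And>n a. n > 0 \<Longrightarrow> a \<in> mat_points ?X n \<Longrightarrow> mat_eval n a s = Some (mat n n (\<lambda>ij. \<Sum>\<pi> | \<pi> permutes {1..k}.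
       c \<pi> * mat_monomial (\<lambda>i. (i, \<pi> i)) [1..<Suc k] n a $$ ij))"
    using ev unfolding evaluates_to_def by blast
  have rs: "(r, s) \<in> rexp_rel ?X" using rexp_class_eq_iff[OF inf r(1) s(1)] r(2) s(2) by simp
  have "k choose h \<le> var_leaves r"
    by (rule binomial_le_var_leaves[OF r(1) _ c h]) (rule rexp_relD[OF rs _ _ _ s(3)])
  also have "\<dots> \<le> card (verts (graph \<Phi>))"
  proof (rule order_trans[OF r(3)], rule card_mono)
    show "finite (verts (graph \<Phi>))"
      using formula unfolding is_formula_def is_circuit_def by (auto dest: fin_digraph.finite_verts)
  qed blast
  finally show ?thesis unfolding circuit_size_def .
qed

theorem mainTheorem8:
  assumes "infinite (UNIV :: 'k::field set)"
  shows "\<exists>c>0. \<forall>\<^sub>F k in sequentially.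
    \<forall>\<Phi> :: ('k, nat \<times> nat, 'v, 'e) circuit.
      is_formula (matrix_vars k) \<Phi> \<and>
      (computes (matrix_vars k) \<Phi> (nc_det k) \<or> computes (matrix_vars k) \<Phi> (nc_perm k)) \<longrightarrow>
      2 powr (c * sqrt (real k) / log 2 (real k)) \<le> real (circuit_size \<Phi>)"
proof (intro exI[of _ "1 / 4 :: real"] conjI eventually_sequentiallyI[of 2] allI impI)
  fix k :: nat and \<Phi> :: "('k, nat \<times> nat, 'v, 'e) circuit"
  assume k: "2 \<le> k" and \<Phi>: "is_formula (matrix_vars k) \<Phi> \<and>
      (computes (matrix_vars k) \<Phi> (nc_det k) \<or> computes (matrix_vars k) \<Phi> (nc_perm k))"
  \<comment> \<open>The middle cut already gives \<open>2 ^ (k div 2)\<close>: as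
    \<open>2 * h \<le> k\<close>, the binomial is at least \<open>(k / h) ^ h \<ge> 2 ^ h\<close>.
    The constant 1/4 comes from \<open>k \<le> 4 * h\<close>, valid from \<open>k = 2\<close> on,
    with the rough bounds \<open>sqrt k \<le> k\<close> and \<open>log 2 k \<ge> 1\<close>.\<close>
  define h where "h = k div 2"
  have h: "0 < h" "h < k" "2 * h \<le> k" "k \<le> 4 * h" using k unfolding h_def by auto
  have sqrt: "sqrt (real k) \<le> real k"
    using k by (intro real_le_lsqrt) (auto simp: power2_eq_square)
  have log: "1 \<le> log 2 (real k)" using k by (simp add: le_log_iff)
  have "1 / 4 * sqrt (real k) / log 2 (real k) \<le> 1 / 4 * sqrt (real k)"
    using log by (intro divide_le_eq[THEN iffD2]) (auto intro: mult_right_mono simp: mult_le_cancel_left1)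
  also have "\<dots> \<le> real h" using sqrt h(4) by simp
  finally have "2 powr (1 / 4 * sqrt (real k) / log 2 (real k)) \<le> 2 powr real h" by simp
  also have "\<dots> = 2 ^ h" by (simp add: powr_realpow)
  also have "\<dots> \<le> (real k / real h) ^ h"
    using h by (intro power_mono) (simp_all add: pos_le_divide_eq)
  also have "\<dots> \<le> real (k choose h)"
    using binomial_ge_n_over_k_pow_k[of h k, where 'a = real] h by simp
  also have "\<dots> \<le> real (circuit_size \<Phi>)"
    using nc_det_perm_formula_size[OF assms conjunct1[OF \<Phi>] conjunct2[OF \<Phi>] h(1,2)] by simp
  finally show "2 powr (1 / 4 * sqrt (real k) / log 2 (real k)) \<le> real (circuit_size \<Phi>)" .
qed simp

end
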